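(* Let $D_0\in Bar$ and let $n$ be the number of infinite bars in $D_0$. Let $d_{D_0}:D\mapsto d_\infty(D,D_0)$ be the bottleneck distance to $D_0$. For generic $D\in Bar_n$ (i.e. for all $D$ in some open and dense subset of $Bar_n$), $d_{D_0}$ is $\infty$-differentiable at $D$. Moreover, for any $m\in\mathbb{N}$ and $\tilde D\in\mathbb{R}^{2m}\times\mathbb{R}^n$ such that $Q_{m,n}(\tilde D)=D$, exactly one of the following possibilities holds: (i) the gradient $\nabla_{\tilde D}(d_{D_0}\circ Q_{m,n})$ has exactly two non-zero components, one with value $\frac12$ and the other with value $-\frac12$; or (ii) the gradient $\nabla_{\tilde D}(d_{D_0}\circ Q_{m,n})$ has a unique non-zero component, with value $1$ or $-1$.
   Context: Barcodes: a barcode is a multiset $D=D'\cup\Delta^\infty$, where $D'$ is a finite multiset of elements of $\mathbb{R}\times(\mathbb{R}\cup\{+\infty\})$ and $\Delta^\infty$ consists of the diagonal $\Delta=\{(b,b)\mid b\in\mathbb{R}\}$ with countably infinite multiplicity. $Bar$ is the set of barcodes; $Bar_n\subset Bar$ is the subset of barcodes with exactly $n$ infinite bars (points with second coordinate $+\infty$, counted with multiplicity). For $m,n\in\mathbb{N}$, $Q_{m,n}:\mathbb{R}^{2m}\times\mathbb{R}^n\to Bar$ is $Q_{m,n}(b_1,d_1,\dots,b_m,d_m,v_1,\dots,v_n)=\{(b_i,d_i)\}_{i=1}^m\cup\{(v_j,+\infty)\}_{j=1}^n\cup\Delta^\infty$. The bottleneck distance is $d_\infty(D,D')=\inf_\gamma\sup_{x\in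 D}\|x-\gamma(x)\|_\infty$, where $\gamma$ ranges over bijections of multisets $D\to D'$ (two points $(v,+\infty),(v',+\infty)$ are at distance $|v-v'|$; a bounded and an unbounded point are at distance $+\infty$). $Bar_n$ has the topology induced by $d_\infty$; $d_{D_0}$ is finite on $Bar_n$. A real-valued map $V$ on $Bar_n$ is $\infty$-differentiable at $D\in Bar_n$ if for all $m\in\mathbb{N}$ and all $\tilde D\in\mathbb{R}^{2m}\times\mathbb{R}^n$ with $Q_{m,n}(\tilde D)=D$, the map $V\circ Q_{m,n}$ is $C^\infty$ on an open neighborhood of $\tilde D$. *)

theory Defs
  imports "HOL-Analysis.Analysis" "HOL-Library.Extended_Nat" "HOL-Library.Multiset"
begin

type_synonym point = "real \<times> ereal"

(* A multiset with possibly infinite multiplicities is its multiplicity function; the value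
   \<infinity> :: enat stands for countably infinite multiplicity. *)
type_synonym barcode = "point \<Rightarrow> enat"

definition Delta_inf :: barcode where
  "Delta_inf p = (if p \<in> range (\<lambda>b. (b, ereal b)) then \<infinity> else 0)"

definition barcode_of :: "point multiset \<Rightarrow> barcode" where
  "barcode_of D' p = enat (count D' p) + Delta_inf p"

definition Bar :: "barcode set" where
  "Bar = {barcode_of D' | D'. \<forall>p \<in># D'. snd p \<noteq> -\<infinity>}"

(* The elements of a multiset counted with multiplicity: the copies of p are (p, 0), (p, 1), ...
   A bijection of multisets is a bijection between these sets. *)
definition copies :: "barcode \<Rightarrow> (point \<times> nat) set" where
  "copies D = {(p, k). enat k < D p}"

definition num_infinite_bars :: "barcode \<Rightarrow> nat" where
  "num_infinite_bars D = card {x \<in> copies D. snd (fst x) = \<infinity>}"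

definition Bar_n :: "nat \<Rightarrow> barcode set" where
  "Bar_n n = {D \<in> Bar. num_infinite_bars D = n}"

(* The case distinction is needed because \<infinity> - \<infinity> = \<infinity> in ereal, whereas two infinite bars
   are at the distance of their first coordinates. *)
definition point_dist :: "point \<Rightarrow> point \<Rightarrow> ereal" where
  "point_dist p q = max (ereal \<bar>fst p - fst q\<bar>) (if snd p = snd q then 0 else \<bar>snd p - snd q\<bar>)"

definition bottleneck :: "barcode \<Rightarrow> barcode \<Rightarrow> ereal" where
  "bottleneck D D' =
     (INF \<gamma> \<in> {\<gamma>. bij_betw \<gamma> (copies D) (copies D')}.
        SUP x \<in> copies D. point_dist (fst x) (fst (\<gamma> x)))"

(* Real-valued, since the bottleneck distance is finite between barcodes with the same number
   of infinite bars. *)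
definition dist_to :: "barcode \<Rightarrow> barcode \<Rightarrow> real" where
  "dist_to D0 D = real_of_ereal (bottleneck D D0)"

definition Bar_topology :: "nat \<Rightarrow> barcode topology" where
  "Bar_topology n = topology (\<lambda>U. U \<subseteq> Bar_n n \<and>
     (\<forall>D \<in> U. \<exists>e > 0. \<forall>D' \<in> Bar_n n. bottleneck D D' < ereal e \<longrightarrow> D' \<in> U))"

lemma istopology_Bar:
  "istopology (\<lambda>U. U \<subseteq> Bar_n n \<and>
     (\<forall>D \<in> U. \<exists>e > 0. \<forall>D' \<in> Bar_n n. bottleneck D D' < ereal e \<longrightarrow> D' \<in> U))"
  unfolding istopology_def
proof (intro conjI allI impI ballI)
  fix S T D
  assume S: "S \<subseteq> Bar_n n \<and>
     (\<forall>D \<in> S. \<exists>e > 0. \<forall>D' \<in> Bar_n n. bottleneck D D' < ereal e \<longrightarrow> D' \<in> S)"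
    and T: "T \<subseteq> Bar_n n \<and>
     (\<forall>D \<in> T. \<exists>e > 0. \<forall>D' \<in> Bar_n n. bottleneck D D' < ereal e \<longrightarrow> D' \<in> T)"
  show "S \<inter> T \<subseteq> Bar_n n" using S by (rule le_infI1[OF conjunct1])
  assume D: "D \<in> S \<inter> T"
  obtain e1 where e1: "e1 > 0" "\<And>D'. D' \<in> Bar_n n \<Longrightarrow> bottleneck D D' < ereal e1 \<Longrightarrow> D' \<in> S"
    using conjunct2[OF S] D by (meson IntD1)
  obtain e2 where e2: "e2 > 0" "\<And>D'. D' \<in> Bar_n n \<Longrightarrow> bottleneck D D' < ereal e2 \<Longrightarrow> D' \<in> T"
    using conjunct2[OF T] D by (meson IntD2)
  show "\<exists>e>0. \<forall>D'\<in>Bar_n n. bottleneck D D' < ereal e \<longrightarrow> D' \<in> S \<inter> T"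
  proof (intro exI[of _ "min e1 e2"] conjI ballI impI IntI)
    show "min e1 e2 > 0" using e1(1) e2(1) by simp
  next
    fix D' assume *: "D' \<in> Bar_n n" "bottleneck D D' < ereal (min e1 e2)"
    have "ereal (min e1 e2) \<le> ereal e1" "ereal (min e1 e2) \<le> ereal e2" by simp_all
    then have "bottleneck D D' < ereal e1" "bottleneck D D' < ereal e2"
      using less_le_trans[OF *(2)] by blast+
    with * e1(2) e2(2) show "D' \<in> S" "D' \<in> T" by simp_all
  qed
next
  fix K D
  assume K: "\<forall>S \<in> K. S \<subseteq> Bar_n n \<and>
     (\<forall>D \<in> S. \<exists>e > 0. \<forall>D' \<in> Bar_n n. bottleneck D D' < ereal e \<longrightarrow> D' \<in> S)"
  show "\<Union>K \<subseteq> Bar_n n"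
  proof (rule Union_least)
    fix S assume "S \<in> K"
    show "S \<subseteq> Bar_n n" using bspec[OF K \<open>S \<in> K\<close>] by (rule conjunct1)
  qed
  assume "D \<in> \<Union>K"
  then obtain S where S: "S \<in> K" "D \<in> S" by (rule UnionE)
  have "\<forall>D \<in> S. \<exists>e > 0. \<forall>D' \<in> Bar_n n. bottleneck D D' < ereal e \<longrightarrow> D' \<in> S"
    using bspec[OF K S(1)] by (rule conjunct2)
  then obtain e where e: "e > 0" "\<forall>D' \<in> Bar_n n. bottleneck D D' < ereal e \<longrightarrow> D' \<in> S"
    using S(2) by meson
  show "\<exists>e>0. \<forall>D'\<in>Bar_n n. bottleneck D D' < ereal e \<longrightarrow> D' \<in> \<Union>K"
    using e S(1) by (intro exI[of _ e]) (meson UnionI)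
qed

lemma openin_Bar_topology:
  "openin (Bar_topology n) U \<longleftrightarrow> U \<subseteq> Bar_n n \<and>
     (\<forall>D \<in> U. \<exists>e > 0. \<forall>D' \<in> Bar_n n. bottleneck D D' < ereal e \<longrightarrow> D' \<in> U)"
  unfolding Bar_topology_def topology_inverse'[OF istopology_Bar] ..

lemma topspace_Bar_topology: "topspace (Bar_topology n) = Bar_n n"
proof -
  have "openin (Bar_topology n) (Bar_n n)"
    unfolding openin_Bar_topology by (auto intro: exI[of _ 1])
  moreover have "topspace (Bar_topology n) \<subseteq> Bar_n n"
    using openin_topspace[of "Bar_topology n"] unfolding openin_Bar_topology by (rule conjunct1)
  ultimately show ?thesis
    using openin_subset by (metis subset_antisym)
qed

(* R^{2m} x R^n is identified with R^{2m+n}, i.e. with the topological space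
   Euclidean_space (2 * m + n) of functions nat \<Rightarrow> real vanishing outside {..<2 * m + n}:
   the coordinates (b_1, d_1, ..., b_m, d_m, v_1, ..., v_n) are numbered 0, ..., 2m+n-1. *)
definition Q_map :: "nat \<Rightarrow> nat \<Rightarrow> (nat \<Rightarrow> real) \<Rightarrow> barcode" where
  "Q_map m n x = barcode_of
     (image_mset (\<lambda>i. (x (2 * i), ereal (x (2 * i + 1)))) (mset_set {..<m}) +
      image_mset (\<lambda>j. (x (2 * m + j), \<infinity>)) (mset_set {..<n}))"

definition partial_deriv :: "nat \<Rightarrow> ((nat \<Rightarrow> real) \<Rightarrow> real) \<Rightarrow> (nat \<Rightarrow> real) \<Rightarrow> real" where
  "partial_deriv i f x = deriv (\<lambda>t. f (x(i := t))) (x i)"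

(* f is C^k on the open subset U of R^N: all iterated partial derivatives of order at most k
   exist and are continuous on U. *)
fun Ck_on :: "nat \<Rightarrow> nat \<Rightarrow> ((nat \<Rightarrow> real) \<Rightarrow> real) \<Rightarrow> (nat \<Rightarrow> real) set \<Rightarrow> bool" where
  "Ck_on N 0 f U \<longleftrightarrow>
     continuous_map (subtopology (Euclidean_space N) U) euclideanreal f"
| "Ck_on N (Suc k) f U \<longleftrightarrow>
     continuous_map (subtopology (Euclidean_space N) U) euclideanreal f \<and>
     (\<forall>i < N. (\<forall>x \<in> U. (\<lambda>t. f (x(i := t))) differentiable at (x i)) \<and>
              Ck_on N k (partial_deriv i f) U)"

definition Cinf_on :: "nat \<Rightarrow> ((nat \<Rightarrow> real) \<Rightarrow> real) \<Rightarrow> (nat \<Rightarrow> real) set \<Rightarrow> bool" where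
  "Cinf_on N f U \<longleftrightarrow> (\<forall>k. Ck_on N k f U)"

definition inf_differentiable_at :: "nat \<Rightarrow> (barcode \<Rightarrow> real) \<Rightarrow> barcode \<Rightarrow> bool" where
  "inf_differentiable_at n V D \<longleftrightarrow>
     (\<forall>m. \<forall>x \<in> topspace (Euclidean_space (2 * m + n)). Q_map m n x = D \<longrightarrow>
        (\<exists>U. openin (Euclidean_space (2 * m + n)) U \<and> x \<in> U \<and>
             Cinf_on (2 * m + n) (V \<circ> Q_map m n) U))"

definition gradient :: "nat \<Rightarrow> ((nat \<Rightarrow> real) \<Rightarrow> real) \<Rightarrow> (nat \<Rightarrow> real) \<Rightarrow> (nat \<Rightarrow> real)" where
  "gradient N f x = (\<lambda>i. if i < N then partial_deriv i f x else 0)"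

definition two_half_components :: "nat \<Rightarrow> (nat \<Rightarrow> real) \<Rightarrow> bool" where
  "two_half_components N g \<longleftrightarrow>
     (\<exists>i j. i \<noteq> j \<and> {k. k < N \<and> g k \<noteq> 0} = {i, j} \<and> g i = 1 / 2 \<and> g j = - 1 / 2)"

definition one_unit_component :: "nat \<Rightarrow> (nat \<Rightarrow> real) \<Rightarrow> bool" where
  "one_unit_component N g \<longleftrightarrow>
     (\<exists>i. {k. k < N \<and> g k \<noteq> 0} = {i} \<and> (g i = 1 \<or> g i = - 1))"

end

theory Submission
  imports Defs "HOL-Computational_Algebra.Polynomial"
begin

text \<open>
  Write \<open>F D\<close> for the bottleneck distance from \<open>D\<close> to \<open>D0\<close>. All barcodes here have finitely
  many points off the diagonal, so a bijection of multisets carries the same information as a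
  finite partial matching in which an unmatched point is sent to the diagonal at the cost of half
  its persistence. Hence the infimum in the bottleneck distance is attained
  (\<open>bottleneck_barcode_on_attained\<close>), and \<open>F D\<close> is always one of finitely many numbers:
  \<open>0\<close>, half the persistence of a bar of \<open>D0\<close>, half the persistence of a bar of \<open>D\<close>, or the
  difference of a coordinate of \<open>D\<close> and one of \<open>D0\<close>. In a parametrisation \<open>Q_map m n x\<close> the
  last two kinds are, up to sign, affine functions of \<open>x\<close> whose linear part is \<open>(\<plusminus>1/2, \<minusplus>1/2)\<close>
  on the two coordinates of a bar, respectively \<open>\<plusminus>1\<close> on one coordinate. The first two kinds do
  not depend on \<open>x\<close> and are called critical values. If \<open>F (Q_map m n x)\<close> is not critical and the
  affine functions take pairwise different values at \<open>x\<close>, then by continuity \<open>F\<close> agrees near \<open>x\<close>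
  with a single one of them (\<open>dist_to_Q_map_locally_affine\<close>). This gives smoothness and the two
  possible gradients in one parametrisation of one barcode.

  The subtle point is that every other parametrisation of \<open>D\<close>, and of every nearby barcode, must
  be covered. These contain extra bars on or near the diagonal, which may well lie where an optimal
  matching would use a diagonal point. Suppose such a bar, of half persistence at most \<open>e\<close>, is
  matched with a bar \<open>q\<close> of \<open>D0\<close> at cost at most \<open>F D\<close>. Sending both to the diagonal instead
  costs at most \<open>F D + e\<close>, being half the persistence of \<open>q\<close>. So if no critical value lies in
  \<open>(F D, F D + e]\<close> the short bars can be discarded without changing the distance
  (\<open>bottleneck_remove_small_points\<close>). It follows that every barcode near a generic \<open>Q_map m n x\<close>
  has, in all its parametrisations, a distance function that is locally the same affine function,
  precomposed with an injective choice of coordinates (\<open>unit_or_half_gradient_near_generic\<close>).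

  Density then requires avoiding the critical values, not only the coincidences between affine
  functions. Avoiding coincidences is possible by an arbitrarily small move because finitely many
  distinct affine functions are separated by most points. Critical values are avoided with
  geodesics: moving every point of \<open>D\<close> towards its partner in an optimal matching scales the
  distance to \<open>D0\<close> exactly by \<open>1 - t\<close> (\<open>bottleneck_geodesic\<close>), so small \<open>t\<close> miss any given
  finite set of values.
\<close>

section \<open>Distances between points, and bijections between barcodes\<close>

text \<open>
  The distance from a point to the diagonal in the supremum norm.
\<close>

definition half_persistence :: "point \<Rightarrow> ereal" where
  "half_persistence p = (if \<bar>snd p\<bar> = \<infinity> then \<infinity> else ereal (\<bar>real_of_ereal (snd p) - fst p\<bar> / 2))"

lemma half_persistence_le_iff:
  "half_persistence p \<le> ereal c \<longleftrightarrow> (\<exists>d. snd p = ereal d \<and> \<bar>d - fst p\<bar> \<le> 2 * c)"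
  by (cases p; cases "snd p") (auto simp: half_persistence_def)

lemma point_dist_le_iff:
  "point_dist p q \<le> ereal c \<longleftrightarrow> \<bar>fst p - fst q\<bar> \<le> c \<and>
     (snd p = snd q \<or> (\<exists>d d'. snd p = ereal d \<and> snd q = ereal d' \<and> \<bar>d - d'\<bar> \<le> c))"
  by (cases p; cases q; cases "snd p"; cases "snd q") (auto simp: point_dist_def)

lemma point_dist_refl: "point_dist p p = 0"
  by (simp add: point_dist_def zero_ereal_def)

lemma point_dist_nonneg: "0 \<le> point_dist p q"
  by (simp add: point_dist_def le_max_iff_disj)

lemma point_dist_commute: "point_dist p q = point_dist q p"
proof -
  have "\<bar>u - v\<bar> = \<bar>v - u\<bar>" for u v :: ereal
  proof (cases u; cases v)
    fix r r' assume "u = ereal r" "v = ereal r'"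
    then show ?thesis by (simp only: ereal_minus(1) abs_ereal.simps(1) abs_minus_commute)
  qed simp_all
  from this[of "snd p" "snd q"] show ?thesis
    unfolding point_dist_def abs_minus_commute[of "fst p"] eq_commute[of "snd p"] by (rule arg_cong)
qed

lemma point_dist_triangle:
  assumes "point_dist p q \<le> ereal c" "point_dist q r \<le> ereal c'"
  shows "point_dist p r \<le> ereal (c + c')"
proof -
  have 1: "\<bar>fst p - fst q\<bar> \<le> c" "\<bar>fst q - fst r\<bar> \<le> c'"
    using assms by (simp_all add: point_dist_le_iff)
  then have "0 \<le> c" "0 \<le> c'" by linarith+
  have "snd p = snd r \<or> (\<exists>d d'. snd p = ereal d \<and> snd r = ereal d' \<and> \<bar>d - d'\<bar> \<le> c + c')"
  proof (cases "snd p = snd q \<or> snd q = snd r")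
    case True
    have "snd p = snd r \<or> (\<exists>d d'. snd p = ereal d \<and> snd r = ereal d' \<and> (\<bar>d - d'\<bar> \<le> c \<or> \<bar>d - d'\<bar> \<le> c'))"
      using assms True unfolding point_dist_le_iff by metis
    moreover have "\<bar>d - d'\<bar> \<le> c + c'" if "\<bar>d - d'\<bar> \<le> c \<or> \<bar>d - d'\<bar> \<le> c'" for d d' :: real
      using that \<open>0 \<le> c\<close> \<open>0 \<le> c'\<close> by linarith
    ultimately show ?thesis by metis
  next
    case False
    then obtain d d' d'' where "snd p = ereal d" "snd q = ereal d'" "snd r = ereal d''"
      "\<bar>d - d'\<bar> \<le> c" "\<bar>d' - d''\<bar> \<le> c'"
      using assms unfolding point_dist_le_iff by auto
    moreover from this have "\<bar>d - d''\<bar> \<le> c + c'" by linarith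
    ultimately show ?thesis by blast
  qed
  moreover have "\<bar>fst p - fst r\<bar> \<le> c + c'" using 1 by linarith
  ultimately show ?thesis unfolding point_dist_le_iff by blast
qed

abbreviation diag :: "real \<Rightarrow> point" where
  "diag t \<equiv> (t, ereal t)"

definition diag_proj :: "point \<Rightarrow> point" where
  "diag_proj p = diag ((fst p + real_of_ereal (snd p)) / 2)"

lemma point_dist_diag_proj:
  "half_persistence p \<le> ereal c \<Longrightarrow> point_dist p (diag_proj p) \<le> ereal c"
proof -
  assume "half_persistence p \<le> ereal c"
  then obtain d where d: "snd p = ereal d" "\<bar>d - fst p\<bar> \<le> 2 * c"
    unfolding half_persistence_le_iff by blast
  then have "\<bar>fst p - (fst p + d) / 2\<bar> \<le> c" "\<bar>d - (fst p + d) / 2\<bar> \<le> c"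
    by (simp_all add: abs_le_iff field_simps)
  then show ?thesis
    unfolding point_dist_le_iff diag_proj_def d(1) real_of_ereal.simps fst_conv snd_conv by blast
qed

text \<open>
  This is what allows a bar matched with a short bar to be sent to the diagonal instead, at little
  extra cost.
\<close>

lemma half_persistence_lipschitz:
  assumes "half_persistence p \<le> ereal e" "point_dist p q \<le> ereal c"
  shows "half_persistence q \<le> ereal (e + c)"
proof -
  obtain d where d: "snd p = ereal d" "\<bar>d - fst p\<bar> \<le> 2 * e"
    using assms(1) unfolding half_persistence_le_iff by blast
  have *: "\<bar>fst p - fst q\<bar> \<le> c" using assms(2) by (simp add: point_dist_le_iff)
  then have "0 \<le> c" by linarith
  then obtain d' where d': "snd q = ereal d'" "\<bar>d - d'\<bar> \<le> c"
    using assms(2) d(1) unfolding point_dist_le_iff by (metis abs_zero diff_self ereal.inject)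
  have "\<bar>d' - fst q\<bar> \<le> 2 * (e + c)" using d(2) d'(2) * by argo
  with d'(1) show ?thesis unfolding half_persistence_le_iff by blast
qed

lemma half_persistence_le_point_dist_diag:
  assumes "point_dist p (diag t) \<le> ereal c"
  shows "half_persistence p \<le> ereal c"
  using half_persistence_lipschitz[of "diag t" 0 p c] assms
  by (simp add: half_persistence_def point_dist_commute)

definition barcode_on :: "'i set \<Rightarrow> ('i \<Rightarrow> point) \<Rightarrow> barcode" where
  "barcode_on I a = barcode_of (image_mset a (mset_set I))"

lemma barcode_on_apply:
  assumes "finite I"
  shows "barcode_on I a p = (if p \<in> range diag then \<infinity> else enat (card {i \<in> I. a i = p}))"
proof -
  have "count (image_mset a (mset_set I)) p = card {i \<in> I. a i = p}"
    using assms by (simp add: count_image_mset_eq_card_vimage)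
  then show ?thesis
    by (auto simp: barcode_on_def barcode_of_def Delta_inf_def)
qed

text \<open>
  Choosing a bijection in each fibre turns a fibrewise count into a bijection that preserves the
  underlying points.
\<close>

lemma enumeration_of_copies:
  fixes f :: "'s \<Rightarrow> point"
  assumes inf: "\<And>p. D p = \<infinity> \<Longrightarrow> countable {s \<in> S. f s = p} \<and> infinite {s \<in> S. f s = p}"
    and fin: "\<And>p. D p \<noteq> \<infinity> \<Longrightarrow> finite {s \<in> S. f s = p} \<and> enat (card {s \<in> S. f s = p}) = D p"
  obtains \<phi> where "bij_betw \<phi> S (copies D)" "\<And>s. s \<in> S \<Longrightarrow> fst (\<phi> s) = f s"
proof -
  have "\<exists>g. bij_betw g {s \<in> S. f s = p} {k. enat k < D p}" for p
  proof (cases "D p = \<infinity>")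
    case True
    then have "bij_betw (to_nat_on {s \<in> S. f s = p}) {s \<in> S. f s = p} {k. enat k < D p}"
      using to_nat_on_infinite[of "{s \<in> S. f s = p}"] inf[OF True] by simp
    then show ?thesis by blast
  next
    case False
    have "{k. enat k < D p} = {0..<card {s \<in> S. f s = p}}"
      using fin[OF False] by (auto simp flip: enat_ord_simps(2))
    then show ?thesis
      using ex_bij_betw_finite_nat fin[OF False] by metis
  qed
  then obtain g where g: "\<And>p. bij_betw (g p) {s \<in> S. f s = p} {k. enat k < D p}"
    by metis
  let ?\<phi> = "\<lambda>s. (f s, g (f s) s)"
  have "inj_on ?\<phi> S"
  proof (rule inj_onI)
    fix s s' assume "s \<in> S" "s' \<in> S" "?\<phi> s = ?\<phi> s'"
    then show "s = s'"
      using g[of "f s'"] by (auto simp: bij_betw_def inj_on_def)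
  qed
  moreover have "?\<phi> ` S = copies D"
  proof (intro set_eqI iffI)
    fix y assume "y \<in> ?\<phi> ` S"
    then obtain s where "s \<in> S" "y = ?\<phi> s" by blast
    then show "y \<in> copies D"
      using bij_betwE[OF g, of "f s"] by (auto simp: copies_def)
  next
    fix y assume "y \<in> copies D"
    then obtain p k where y: "y = (p, k)" "enat k < D p"
      by (auto simp: copies_def)
    then have "k \<in> g p ` {s \<in> S. f s = p}"
      using bij_betw_imp_surj_on[OF g[of p]] by simp
    then obtain s where "s \<in> S" "f s = p" "g p s = k" by blast
    then show "y \<in> ?\<phi> ` S" using y by auto
  qed
  ultimately show ?thesis
    using that[of ?\<phi>] by (simp add: bij_betw_def)
qed

text \<open>
  Every barcode given by a finite family consists of the members of the family together with
  countably many copies of each diagonal point. A member lying on the diagonal is absorbed by the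
  infinite multiplicity there, so the copies may be indexed by this disjoint sum even then.
\<close>

abbreviation tagged_copies :: "'i set \<Rightarrow> ('i + real \<times> nat) set" where
  "tagged_copies I \<equiv> I <+> (UNIV :: (real \<times> nat) set)"

abbreviation tagged_point :: "('i \<Rightarrow> point) \<Rightarrow> 'i + real \<times> nat \<Rightarrow> point" where
  "tagged_point a \<equiv> case_sum a (\<lambda>(t, k). diag t)"

lemma copies_barcode_on:
  assumes I: "finite I"
  obtains \<phi> where "bij_betw \<phi> (tagged_copies I) (copies (barcode_on I a))"
    "\<And>s. s \<in> tagged_copies I \<Longrightarrow> fst (\<phi> s) = tagged_point a s"
proof (rule enumeration_of_copies[of "barcode_on I a" "tagged_copies I" "tagged_point a"])
  have fibre: "{s \<in> tagged_copies I. tagged_point a s = p} =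
      Inl ` {i \<in> I. a i = p} \<union> (if p \<in> range diag then Inr ` ({fst p} \<times> UNIV) else {})" for p
    by (cases p) (auto simp: Plus_def image_iff split: if_splits)
  fix p
  {
    assume "barcode_on I a p = \<infinity>"
    then have p: "p \<in> range diag"
      using barcode_on_apply[OF I, of a p] by (auto split: if_splits)
    have "infinite ({fst p} \<times> (UNIV :: nat set))"
      by (simp add: finite_cartesian_product_iff)
    then have "infinite (Inr ` ({fst p} \<times> UNIV) :: ('a + real \<times> nat) set)"
      by (simp add: finite_image_iff)
    then show "countable {s \<in> tagged_copies I. tagged_point a s = p} \<and>
        infinite {s \<in> tagged_copies I. tagged_point a s = p}"
      unfolding fibre using I p by (simp add: countable_finite)
  }
  {
    assume "barcode_on I a p \<noteq> \<infinity>"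
    then have p: "p \<notin> range diag"
      using barcode_on_apply[OF I, of a p] by (auto split: if_splits)
    then show "finite {s \<in> tagged_copies I. tagged_point a s = p} \<and>
        enat (card {s \<in> tagged_copies I. tagged_point a s = p}) = barcode_on I a p"
      unfolding fibre using I by (simp add: barcode_on_apply card_image)
  }
qed (rule that)

lemma num_infinite_bars_barcode_on:
  assumes I: "finite I"
  shows "num_infinite_bars (barcode_on I a) = card {i \<in> I. snd (a i) = \<infinity>}"
proof -
  obtain \<phi> where \<phi>: "bij_betw \<phi> (tagged_copies I) (copies (barcode_on I a))"
    "\<And>s. s \<in> tagged_copies I \<Longrightarrow> fst (\<phi> s) = tagged_point a s"
    using copies_barcode_on[OF I, of a] by blast
  have "{x \<in> copies (barcode_on I a). snd (fst x) = \<infinity>} =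
      \<phi> ` {s \<in> tagged_copies I. snd (tagged_point a s) = \<infinity>}"
    unfolding bij_betw_imp_surj_on[OF \<phi>(1), symmetric] using \<phi>(2) by force
  also have "{s \<in> tagged_copies I. snd (tagged_point a s) = \<infinity>} = Inl ` {i \<in> I. snd (a i) = \<infinity>}"
    by auto
  finally have "num_infinite_bars (barcode_on I a) = card (\<phi> ` Inl ` {i \<in> I. snd (a i) = \<infinity>})"
    by (simp add: num_infinite_bars_def)
  also have "\<dots> = card (Inl ` {i \<in> I. snd (a i) = \<infinity>} :: ('a + real \<times> nat) set)"
    by (rule card_image, rule inj_on_subset[OF bij_betw_imp_inj_on[OF \<phi>(1)]]) auto
  also have "\<dots> = card {i \<in> I. snd (a i) = \<infinity>}"
    by (rule card_image) simp
  finally show ?thesis .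
qed

lemma bottleneck_nonneg: "0 \<le> bottleneck D D'" if "copies D \<noteq> {}"
  unfolding bottleneck_def
proof (rule INF_greatest)
  fix \<gamma>
  obtain x where x: "x \<in> copies D" using \<open>copies D \<noteq> {}\<close> by blast
  show "0 \<le> (SUP x\<in>copies D. point_dist (fst x) (fst (\<gamma> x)))"
    by (rule SUP_upper2[OF x point_dist_nonneg])
qed

lemma bottleneck_leI:
  assumes "bij_betw \<gamma> (copies D) (copies D')"
    and "\<And>x. x \<in> copies D \<Longrightarrow> point_dist (fst x) (fst (\<gamma> x)) \<le> c"
  shows "bottleneck D D' \<le> c"
  unfolding bottleneck_def
  by (rule INF_lower2[of \<gamma>]) (use assms in \<open>auto intro: SUP_least\<close>)

lemma bottleneck_lessE:
  assumes "bottleneck D D' < c"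
  obtains \<gamma> where "bij_betw \<gamma> (copies D) (copies D')"
    "\<And>x. x \<in> copies D \<Longrightarrow> point_dist (fst x) (fst (\<gamma> x)) \<le> c"
proof -
  obtain \<gamma> where \<gamma>: "bij_betw \<gamma> (copies D) (copies D')"
    "(SUP x\<in>copies D. point_dist (fst x) (fst (\<gamma> x))) < c"
    using assms unfolding bottleneck_def INF_less_iff by blast
  have "point_dist (fst x) (fst (\<gamma> x)) \<le> c" if "x \<in> copies D" for x
    using SUP_upper[OF that, of "\<lambda>x. point_dist (fst x) (fst (\<gamma> x))"] \<gamma>(2) by order
  with \<gamma>(1) show ?thesis by (rule that)
qed

lemma bottleneck_commute: "bottleneck D D' = bottleneck D' D"
proof -
  have "bottleneck D' D \<le> bottleneck D D'" for D D'
  proof (rule dense_ge)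
    fix c assume "bottleneck D D' < c"
    then obtain \<gamma> where \<gamma>: "bij_betw \<gamma> (copies D) (copies D')"
      "\<And>x. x \<in> copies D \<Longrightarrow> point_dist (fst x) (fst (\<gamma> x)) \<le> c"
      using bottleneck_lessE by blast
    show "bottleneck D' D \<le> c"
    proof (rule bottleneck_leI)
      show "bij_betw (inv_into (copies D) \<gamma>) (copies D') (copies D)"
        by (rule bij_betw_inv_into[OF \<gamma>(1)])
      fix y assume y: "y \<in> copies D'"
      have "inv_into (copies D) \<gamma> y \<in> copies D"
        using bij_betwE[OF bij_betw_inv_into[OF \<gamma>(1)]] y by blast
      from \<gamma>(2)[OF this] show "point_dist (fst y) (fst (inv_into (copies D) \<gamma> y)) \<le> c"
        by (simp add: bij_betw_inv_into_right[OF \<gamma>(1) y] point_dist_commute)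
    qed
  qed
  then show ?thesis by (simp add: order_antisym)
qed

lemma bottleneck_triangle:
  assumes "bottleneck D D' \<le> ereal c" "bottleneck D' D'' \<le> ereal c'"
  shows "bottleneck D D'' \<le> ereal (c + c')"
proof (rule ereal_le_epsilon2)
  fix e :: real assume e: "0 < e"
  have "bottleneck D D' < ereal (c + e / 2)" "bottleneck D' D'' < ereal (c' + e / 2)"
    using assms e by (auto elim: order_le_less_trans)
  then obtain \<gamma> \<gamma>' where \<gamma>: "bij_betw \<gamma> (copies D) (copies D')"
      "\<And>x. x \<in> copies D \<Longrightarrow> point_dist (fst x) (fst (\<gamma> x)) \<le> ereal (c + e / 2)"
    and \<gamma>': "bij_betw \<gamma>' (copies D') (copies D'')"
      "\<And>x. x \<in> copies D' \<Longrightarrow> point_dist (fst x) (fst (\<gamma>' x)) \<le> ereal (c' + e / 2)"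
    by (elim bottleneck_lessE) blast
  have "bottleneck D D'' \<le> ereal ((c + e / 2) + (c' + e / 2))"
  proof (rule bottleneck_leI)
    show "bij_betw (\<gamma>' \<circ> \<gamma>) (copies D) (copies D'')"
      by (rule bij_betw_trans[OF \<gamma>(1) \<gamma>'(1)])
    fix x assume x: "x \<in> copies D"
    then have "\<gamma> x \<in> copies D'" using bij_betwE[OF \<gamma>(1)] by blast
    from point_dist_triangle[OF \<gamma>(2)[OF x] \<gamma>'(2)[OF this]]
    show "point_dist (fst x) (fst ((\<gamma>' \<circ> \<gamma>) x)) \<le> ereal ((c + e / 2) + (c' + e / 2))" by simp
  qed
  then show "bottleneck D D'' \<le> ereal (c + c') + ereal e" by (simp add: algebra_simps)
qed

section \<open>Bijections between barcodes as finite partial matchings\<close>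

text \<open>
  A partial matching of cost \<open>c\<close>; points left unmatched are sent to the diagonal.
\<close>

definition is_matching :: "'i set \<Rightarrow> ('i \<Rightarrow> point) \<Rightarrow> 'j set \<Rightarrow> ('j \<Rightarrow> point) \<Rightarrow> ereal \<Rightarrow> ('i \<times> 'j) set \<Rightarrow> bool"
  where "is_matching I a J b c M \<longleftrightarrow>
    M \<subseteq> I \<times> J \<and> inj_on fst M \<and> inj_on snd M \<and>
    (\<forall>(i, j) \<in> M. point_dist (a i) (b j) \<le> c) \<and>
    (\<forall>i \<in> I - fst ` M. half_persistence (a i) \<le> c) \<and>
    (\<forall>j \<in> J - snd ` M. half_persistence (b j) \<le> c)"

lemma is_matching_unique:
  assumes "is_matching I a J b c M"
  shows "(i, j) \<in> M \<Longrightarrow> (i, j') \<in> M \<Longrightarrow> j = j'"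
    and "(i, j) \<in> M \<Longrightarrow> (i', j) \<in> M \<Longrightarrow> i = i'"
  using assms inj_onD[of fst M "(i, j)" "(i, j')"] inj_onD[of snd M "(i, j)" "(i', j)"]
  by (simp_all add: is_matching_def)

text \<open>
  The bijection matches members with equal index, and each diagonal point with itself.
\<close>

lemma bottleneck_barcode_on_same_index:
  assumes K: "finite K" and ab: "\<And>k. k \<in> K \<Longrightarrow> point_dist (a k) (b k) \<le> c" and "0 \<le> c"
  shows "bottleneck (barcode_on K a) (barcode_on K b) \<le> c"
proof -
  obtain \<phi> where \<phi>: "bij_betw \<phi> (tagged_copies K) (copies (barcode_on K a))"
    "\<And>s. s \<in> tagged_copies K \<Longrightarrow> fst (\<phi> s) = tagged_point a s"
    using copies_barcode_on[OF K, of a] by blast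
  obtain \<psi> where \<psi>: "bij_betw \<psi> (tagged_copies K) (copies (barcode_on K b))"
    "\<And>s. s \<in> tagged_copies K \<Longrightarrow> fst (\<psi> s) = tagged_point b s"
    using copies_barcode_on[OF K, of b] by blast
  show ?thesis
  proof (rule bottleneck_leI)
    show "bij_betw (\<psi> \<circ> inv_into (tagged_copies K) \<phi>)
        (copies (barcode_on K a)) (copies (barcode_on K b))"
      by (rule bij_betw_trans[OF bij_betw_inv_into[OF \<phi>(1)] \<psi>(1)])
    fix x assume "x \<in> copies (barcode_on K a)"
    then obtain s where s: "s \<in> tagged_copies K" "x = \<phi> s"
      using bij_betw_imp_surj_on[OF \<phi>(1)] by blast
    have "point_dist (tagged_point a s) (tagged_point b s) \<le> c"
      using s(1) ab \<open>0 \<le> c\<close> by (auto simp: point_dist_refl)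
    then show "point_dist (fst x) (fst ((\<psi> \<circ> inv_into (tagged_copies K) \<phi>) x)) \<le> c"
      using \<phi>(2) \<psi>(2) s bij_betw_inv_into_left[OF \<phi>(1)] by simp
  qed
qed

text \<open>
  A partial matching becomes a total one after each family is enlarged by the diagonal projections
  of the unmatched points of the other. Padding with diagonal points does not change the barcodes.
  The total form is what geodesics are built from.
\<close>

lemma matching_padding:
  fixes I :: "'i set" and J :: "'j set"
  assumes I: "finite I" and J: "finite J" and M: "is_matching I a J b (ereal c) M"
  obtains K :: "('i + 'j) set" and a' b' where "finite K"
    "barcode_on K a' = barcode_on I a" "barcode_on K b' = barcode_on J b"
    "\<And>k. k \<in> K \<Longrightarrow> point_dist (a' k) (b' k) \<le> ereal c"
proof -
  note M' = M[unfolded is_matching_def]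
  define K where "K = I <+> (J - snd ` M)"
  \<comment> \<open>the partner of a matched index\<close>
  define h where "h i = (THE j. (i, j) \<in> M)" for i
  have h: "h i = j" if "(i, j) \<in> M" for i j
    unfolding h_def
  proof (rule the_equality)
    show "(i, j) \<in> M" by (rule that)
    fix j' assume "(i, j') \<in> M"
    then show "j' = j" by (rule is_matching_unique(1)[OF M _ that])
  qed
  define a' where "a' = case_sum a (\<lambda>j. diag_proj (b j))"
  define b' where "b' = case_sum (\<lambda>i. if i \<in> fst ` M then b (h i) else diag_proj (a i)) b"
  have K: "finite K" using I J by (simp add: K_def)
  have diag_proj: "diag_proj q \<in> range diag" for q
    unfolding diag_proj_def by (rule rangeI)
  have "barcode_on K a' p = barcode_on I a p" for p
  proof (cases "p \<in> range diag")
    case False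
    have a'_Inl: "a' (Inl i) = a i" for i by (simp add: a'_def)
    have a'_Inr: "a' (Inr j) \<noteq> p" for j
      using False diag_proj[of "b j"] unfolding a'_def sum.case(2) by metis
    have "{k \<in> K. a' k = p} \<subseteq> Inl ` {i \<in> I. a i = p}"
    proof
      fix k assume k: "k \<in> {k \<in> K. a' k = p}"
      show "k \<in> Inl ` {i \<in> I. a i = p}"
      proof (cases k)
        case (Inl i)
        then show ?thesis using k by (auto simp: K_def a'_Inl)
      next
        case (Inr j)
        then show ?thesis using k a'_Inr[of j] by blast
      qed
    qed
    moreover have "Inl ` {i \<in> I. a i = p} \<subseteq> {k \<in> K. a' k = p}"
      by (auto simp: K_def a'_def)
    ultimately have "{k \<in> K. a' k = p} = Inl ` {i \<in> I. a i = p}"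
      by (rule order_antisym)
    then show ?thesis
      using False I K by (simp add: barcode_on_apply card_image)
  qed (simp add: barcode_on_apply I K)
  moreover have "barcode_on K b' p = barcode_on J b p" for p
  proof (cases "p \<in> range diag")
    case False
    let ?r = "case_sum h (\<lambda>j. j) :: 'i + 'j \<Rightarrow> 'j"
    have "bij_betw ?r {k \<in> K. b' k = p} {j \<in> J. b j = p}"
    proof (rule bij_betw_byWitness[where f' = "\<lambda>j. if j \<in> snd ` M then Inl (THE i. (i, j) \<in> M) else Inr j"])
      have inv: "(THE i. (i, j) \<in> M) = i" if "(i, j) \<in> M" for i j
        by (rule the_equality, rule that, rule is_matching_unique(2)[OF M _ that])
      have matched: "\<exists>j. (i, j) \<in> M \<and> h i = j \<and> b j = p \<and> i \<in> I \<and> j \<in> J"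
        if "Inl i \<in> K" "b' (Inl i) = p" for i
      proof -
        have "i \<in> fst ` M"
        proof (rule ccontr)
          assume "i \<notin> fst ` M"
          then have "p = diag_proj (a i)" using that(2) by (simp add: b'_def)
          then show False using False diag_proj[of "a i"] by blast
        qed
        then obtain j where "(i, j) \<in> M" by force
        moreover from this have "h i = j" "i \<in> I" "j \<in> J" using h M' by auto
        moreover have "b (h i) = p"
          using that(2) \<open>i \<in> fst ` M\<close> by (simp add: b'_def)
        ultimately show ?thesis by blast
      qed
      show "\<forall>k\<in>{k \<in> K. b' k = p}.
          (if ?r k \<in> snd ` M then Inl (THE i. (i, ?r k) \<in> M) else Inr (?r k)) = k"
      proof
        fix k assume k: "k \<in> {k \<in> K. b' k = p}"
        show "(if ?r k \<in> snd ` M then Inl (THE i. (i, ?r k) \<in> M) else Inr (?r k)) = k"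
        proof (cases k)
          case (Inl i)
          then obtain j where j: "(i, j) \<in> M" "h i = j" using k matched[of i] by blast
          then have "j \<in> snd ` M" by force
          then show ?thesis using inv[OF j(1)] j Inl by simp
        next
          case (Inr j)
          then show ?thesis using k by (auto simp: K_def)
        qed
      qed
      show "\<forall>j\<in>{j \<in> J. b j = p}.
          ?r (if j \<in> snd ` M then Inl (THE i. (i, j) \<in> M) else Inr j) = j"
      proof
        fix j
        show "?r (if j \<in> snd ` M then Inl (THE i. (i, j) \<in> M) else Inr j) = j"
        proof (cases "j \<in> snd ` M")
          case True
          then obtain i where "(i, j) \<in> M" by force
          then show ?thesis using True inv h by simp
        qed simp
      qed
      show "?r ` {k \<in> K. b' k = p} \<subseteq> {j \<in> J. b j = p}"
      proof clarify
        fix k assume k: "k \<in> K" "p = b' k"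
        show "?r k \<in> J \<and> b (?r k) = b' k"
        proof (cases k)
          case (Inl i)
          then show ?thesis using k matched[of i] by auto
        next
          case (Inr j)
          then show ?thesis using k by (auto simp: K_def b'_def)
        qed
      qed
      show "(\<lambda>j. if j \<in> snd ` M then Inl (THE i. (i, j) \<in> M) else Inr j) ` {j \<in> J. b j = p}
          \<subseteq> {k \<in> K. b' k = p}"
      proof clarify
        fix j assume j: "j \<in> J" "p = b j"
        show "(if j \<in> snd ` M then Inl (THE i. (i, j) \<in> M) else Inr j) \<in> K \<and>
            b' (if j \<in> snd ` M then Inl (THE i. (i, j) \<in> M) else Inr j) = b j"
        proof (cases "j \<in> snd ` M")
          case True
          then obtain i where i: "(i, j) \<in> M" by force
          then have "i \<in> I" using M' by blast
          moreover have "i \<in> fst ` M" using image_eqI[OF _ i, of i fst] by simp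
          ultimately show ?thesis using True inv[OF i] h[OF i] by (simp add: K_def b'_def InlI)
        next
          case False
          then show ?thesis using j by (simp add: K_def b'_def InrI)
        qed
      qed
    qed
    then show ?thesis
      using False J K by (simp add: barcode_on_apply bij_betw_same_card)
  qed (simp add: barcode_on_apply J K)
  moreover have "point_dist (a' k) (b' k) \<le> ereal c" if k: "k \<in> K" for k
  proof (cases k)
    case (Inl i)
    then have "i \<in> I" using k by (auto simp: K_def)
    show ?thesis
    proof (cases "i \<in> fst ` M")
      case True
      then obtain j where j: "(i, j) \<in> M" by force
      then have "point_dist (a i) (b j) \<le> ereal c" using M' by blast
      then show ?thesis using Inl True h[OF j] by (simp add: a'_def b'_def)
    next
      case False
      then show ?thesis
        using Inl \<open>i \<in> I\<close> M' by (simp add: a'_def b'_def point_dist_diag_proj)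
    qed
  next
    case (Inr j)
    then have "half_persistence (b j) \<le> ereal c" using k M' by (auto simp: K_def)
    from point_dist_diag_proj[OF this] show ?thesis
      using Inr by (simp add: a'_def b'_def point_dist_commute)
  qed
  ultimately show ?thesis using K that[of K a' b'] by blast
qed

lemma bottleneck_le_of_matching:
  assumes "finite I" "finite J" "is_matching I a J b (ereal c) M" "0 \<le> c"
  shows "bottleneck (barcode_on I a) (barcode_on J b) \<le> ereal c"
proof -
  obtain K :: "('a + 'b) set" and a' b' where "finite K"
    "barcode_on K a' = barcode_on I a" "barcode_on K b' = barcode_on J b"
    "\<And>k. k \<in> K \<Longrightarrow> point_dist (a' k) (b' k) \<le> ereal c"
    using matching_padding[OF assms(1-3)] by blast
  then show ?thesis
    using bottleneck_barcode_on_same_index[of K a' b' "ereal c"] \<open>0 \<le> c\<close> by simp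
qed

text \<open>
  A bijection restricts to a partial matching of the given families: a member paired with one of
  the diagonal copies is treated as unmatched, since its distance to the diagonal is no larger.
\<close>

lemma matching_of_bottleneck_less:
  assumes I: "finite I" and J: "finite J"
    and less: "bottleneck (barcode_on I a) (barcode_on J b) < ereal c"
  obtains M where "is_matching I a J b (ereal c) M"
proof -
  obtain \<phi> where \<phi>: "bij_betw \<phi> (tagged_copies I) (copies (barcode_on I a))"
    "\<And>s. s \<in> tagged_copies I \<Longrightarrow> fst (\<phi> s) = tagged_point a s"
    using copies_barcode_on[OF I, of a] by blast
  obtain \<psi> where \<psi>: "bij_betw \<psi> (tagged_copies J) (copies (barcode_on J b))"
    "\<And>s. s \<in> tagged_copies J \<Longrightarrow> fst (\<psi> s) = tagged_point b s"
    using copies_barcode_on[OF J, of b] by blast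
  obtain \<gamma> where \<gamma>: "bij_betw \<gamma> (copies (barcode_on I a)) (copies (barcode_on J b))"
    "\<And>x. x \<in> copies (barcode_on I a) \<Longrightarrow> point_dist (fst x) (fst (\<gamma> x)) \<le> ereal c"
    using bottleneck_lessE[OF less] by blast
  define g where "g = inv_into (tagged_copies J) \<psi> \<circ> (\<gamma> \<circ> \<phi>)"
  have g: "bij_betw g (tagged_copies I) (tagged_copies J)"
    unfolding g_def by (intro bij_betw_trans[OF bij_betw_trans[OF \<phi>(1) \<gamma>(1)]] bij_betw_inv_into \<psi>(1))
  have dist: "point_dist (tagged_point a s) (tagged_point b (g s)) \<le> ereal c"
    if s: "s \<in> tagged_copies I" for s
  proof -
    have x: "\<phi> s \<in> copies (barcode_on I a)" using bij_betwE[OF \<phi>(1)] s by blast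
    then have "\<gamma> (\<phi> s) \<in> copies (barcode_on J b)" using bij_betwE[OF \<gamma>(1)] by blast
    then have "\<psi> (g s) = \<gamma> (\<phi> s)"
      using bij_betw_inv_into_right[OF \<psi>(1)] by (simp add: g_def)
    moreover have "g s \<in> tagged_copies J" using bij_betwE[OF g] s by blast
    ultimately show ?thesis using \<gamma>(2)[OF x] \<phi>(2)[OF s] \<psi>(2)[of "g s"] by simp
  qed
  define M where "M = {(i, j). i \<in> I \<and> j \<in> J \<and> g (Inl i) = Inl j}"
  have "inj_on fst M" by (auto simp: inj_on_def M_def)
  moreover have "inj_on snd M"
  proof (rule inj_onI, clarsimp simp: M_def)
    fix i i' j assume "i \<in> I" "i' \<in> I" "g (Inl i) = Inl j" "g (Inl i') = Inl j"
    then have "(Inl i :: 'a + real \<times> nat) = Inl i'"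
      by (intro inj_onD[OF bij_betw_imp_inj_on[OF g]]) auto
    then show "i = i'" by simp
  qed
  moreover have "point_dist (a i) (b j) \<le> ereal c" if "(i, j) \<in> M" for i j
    using that dist[of "Inl i"] by (auto simp: M_def)
  moreover have "half_persistence (a i) \<le> ereal c" if i: "i \<in> I - fst ` M" for i
  proof -
    have "g (Inl i) \<in> tagged_copies J" using bij_betwE[OF g] i by blast
    moreover have "g (Inl i) \<noteq> Inl j" if "j \<in> J" for j
      using i that by (force simp: M_def)
    ultimately obtain t k where "g (Inl i) = Inr (t, k)" by auto
    then show ?thesis
      using dist[of "Inl i"] i by (auto intro: half_persistence_le_point_dist_diag)
  qed
  moreover have "half_persistence (b j) \<le> ereal c" if j: "j \<in> J - snd ` M" for j
  proof -
    have "Inl j \<in> g ` tagged_copies I" using j bij_betw_imp_surj_on[OF g] by blast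
    then obtain s where s: "s \<in> tagged_copies I" "g s = Inl j" by (metis imageE)
    moreover have "s \<noteq> Inl i" if "i \<in> I" for i
      using j that s by (force simp: M_def)
    ultimately obtain t k where "s = Inr (t, k)" by auto
    then show ?thesis
      using dist[OF s(1)] s(2)
      by (auto intro: half_persistence_le_point_dist_diag simp: point_dist_commute)
  qed
  moreover have "M \<subseteq> I \<times> J" by (auto simp: M_def)
  ultimately have "is_matching I a J b (ereal c) M"
    unfolding is_matching_def by blast
  then show ?thesis by (rule that)
qed

text \<open>
  All costs that can occur in a matching between the two families. The value \<open>0\<close> is included
  because it is the cost of the empty matching between empty families.
\<close>

definition cost_values :: "'i set \<Rightarrow> ('i \<Rightarrow> point) \<Rightarrow> 'j set \<Rightarrow> ('j \<Rightarrow> point) \<Rightarrow> ereal set" where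
  "cost_values I a J b = insert 0 ((\<lambda>(i, j). point_dist (a i) (b j)) ` (I \<times> J) \<union>
     (half_persistence \<circ> a) ` I \<union> (half_persistence \<circ> b) ` J)"

lemma finite_cost_values: "finite I \<Longrightarrow> finite J \<Longrightarrow> finite (cost_values I a J b)"
  by (simp add: cost_values_def)

text \<open>
  Being a matching of cost \<open>c\<close> only depends on which of the finitely many possible costs are at
  most \<open>c\<close>.
\<close>

lemma is_matching_mono:
  assumes "is_matching I a J b c M" "\<And>v. v \<in> cost_values I a J b \<Longrightarrow> v \<le> c \<Longrightarrow> v \<le> c'"
  shows "is_matching I a J b c' M"
proof -
  note M = assms(1)[unfolded is_matching_def]
  have "point_dist (a i) (b j) \<le> c'" if "(i, j) \<in> M" for i j
    using M that by (intro assms(2)) (auto simp: cost_values_def)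
  moreover have "half_persistence (a i) \<le> c'" if "i \<in> I - fst ` M" for i
    using M that by (intro assms(2)) (simp_all add: cost_values_def)
  moreover have "half_persistence (b j) \<le> c'" if "j \<in> J - snd ` M" for j
    using M that by (intro assms(2)) (simp_all add: cost_values_def)
  ultimately show ?thesis
    using M unfolding is_matching_def by blast
qed

text \<open>
  The threshold of a matching can be moved within a gap of the finite set of possible costs:
  downwards from slightly above the infimum, which gives an optimal matching, and then down to the
  next possible cost, which shows that the infimum is one.
\<close>

lemma bottleneck_barcode_on_attained:
  assumes I: "finite I" and J: "finite J"
    and f: "bottleneck (barcode_on I a) (barcode_on J b) = ereal f"
  shows "ereal f \<in> cost_values I a J b" and "\<exists>M. is_matching I a J b (ereal f) M"
proof -
  let ?V = "cost_values I a J b"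
  have V: "finite ?V" by (rule finite_cost_values[OF I J])
  have pos: "0 \<le> f"
  proof -
    obtain \<phi> where "bij_betw \<phi> (tagged_copies I) (copies (barcode_on I a))"
      using copies_barcode_on[OF I, of a] by blast
    moreover have "Inr (0, 0) \<in> tagged_copies I" by blast
    ultimately have "copies (barcode_on I a) \<noteq> {}" using bij_betwE by fastforce
    from bottleneck_nonneg[OF this, of "barcode_on J b"] show ?thesis by (simp add: f)
  qed
  have "\<exists>c'. ereal f < ereal c' \<and> (\<forall>v\<in>{v\<in>?V. ereal f < v}. ereal c' < v)"
  proof -
    have "ereal f < Min (insert \<infinity> {v\<in>?V. ereal f < v})" using V by simp
    then obtain c' where "ereal f < ereal c'" "ereal c' < Min (insert \<infinity> {v\<in>?V. ereal f < v})"
      using ereal_dense2 by blast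
    then show ?thesis using V by auto
  qed
  then obtain c' where c': "ereal f < ereal c'" "\<And>v. v \<in> ?V \<Longrightarrow> ereal f < v \<Longrightarrow> ereal c' < v"
    by blast
  obtain M where M: "is_matching I a J b (ereal c') M"
    using matching_of_bottleneck_less[OF I J] c'(1) f by metis
  have M: "is_matching I a J b (ereal f) M"
  proof (rule is_matching_mono[OF M], rule ccontr)
    fix v assume "v \<in> ?V" "v \<le> ereal c'" "\<not> v \<le> ereal f"
    then show False using c'(2)[of v] by (metis not_le)
  qed
  then show "\<exists>M. is_matching I a J b (ereal f) M" ..
  define v where "v = Max {v \<in> ?V. v \<le> ereal f}"
  have "0 \<in> {v \<in> ?V. v \<le> ereal f}" using pos by (simp add: cost_values_def)
  then have v: "v \<in> ?V" "v \<le> ereal f" "0 \<le> v"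
    using Max_in[of "{v \<in> ?V. v \<le> ereal f}"] V Max_ge[of "{v \<in> ?V. v \<le> ereal f}" 0]
    unfolding v_def by (fastforce simp del: Max_in)+
  then obtain r where r: "v = ereal r" by (cases v) auto
  have "is_matching I a J b (ereal r) M"
  proof (rule is_matching_mono[OF M])
    fix w assume "w \<in> ?V" "w \<le> ereal f"
    then have "w \<le> v" unfolding v_def using V by (intro Max_ge) auto
    then show "w \<le> ereal r" by (simp add: r)
  qed
  then have "bottleneck (barcode_on I a) (barcode_on J b) \<le> ereal r"
    by (rule bottleneck_le_of_matching[OF I J]) (use v r in simp)
  then have "v = ereal f" using f r v by simp
  with v show "ereal f \<in> ?V" by simp
qed

section \<open>Short bars, parametrisations and geodesics\<close>

lemma barcode_on_reindex: "inj_on \<sigma> I \<Longrightarrow> barcode_on (\<sigma> ` I) a = barcode_on I (a \<circ> \<sigma>)"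
  by (simp add: barcode_on_def flip: image_mset_mset_set multiset.map_comp)

text \<open>
  Bars of half persistence at most \<open>e\<close> may be discarded. Adding them to a matching of the others
  is free since \<open>e \<le> g\<close>. Removing them from an optimal matching leaves their partners unmatched;
  by the Lipschitz property these partners have half persistence at most \<open>e + f\<close>, and hence at
  most \<open>f\<close> by the gap hypothesis.
\<close>

lemma bottleneck_remove_small_points:
  assumes I': "finite I'" and J: "finite J" and "I \<subseteq> I'"
    and small: "\<And>i. i \<in> I' - I \<Longrightarrow> half_persistence (a i) \<le> ereal e"
    and f: "bottleneck (barcode_on I' a) (barcode_on J b) = ereal f"
    and g: "bottleneck (barcode_on I a) (barcode_on J b) = ereal g"
    and "0 \<le> f" "0 \<le> g" "e \<le> g"
    and gap: "\<And>j. j \<in> J \<Longrightarrow> half_persistence (b j) \<le> ereal (e + f) \<Longrightarrow> half_persistence (b j) \<le> ereal f"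
  shows "f = g"
proof (rule order_antisym)
  have I: "finite I" using I' \<open>I \<subseteq> I'\<close> by (rule finite_subset[rotated])
  obtain M where "is_matching I a J b (ereal g) M"
    using bottleneck_barcode_on_attained(2)[OF I J g] by blast
  note M = this[unfolded is_matching_def]
  have "half_persistence (a i) \<le> ereal g" if "i \<in> I' - fst ` M" for i
  proof (cases "i \<in> I")
    case False
    then have "half_persistence (a i) \<le> ereal e" using small that by blast
    also have "ereal e \<le> ereal g" using \<open>e \<le> g\<close> by simp
    finally show ?thesis .
  qed (use M that in blast)
  then have "is_matching I' a J b (ereal g) M"
    using M \<open>I \<subseteq> I'\<close> unfolding is_matching_def by blast
  from bottleneck_le_of_matching[OF I' J this] show "f \<le> g"
    using f \<open>0 \<le> g\<close> by simp
  obtain M' where "is_matching I' a J b (ereal f) M'"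
    using bottleneck_barcode_on_attained(2)[OF I' J f] by blast
  note M' = this[unfolded is_matching_def]
  define N where "N = {(i, j) \<in> M'. i \<in> I}"
  have N: "N \<subseteq> M'" by (auto simp: N_def)
  have "half_persistence (a i) \<le> ereal f" if i: "i \<in> I - fst ` N" for i
  proof -
    have "i \<notin> fst ` M'"
    proof
      assume "i \<in> fst ` M'"
      then obtain j where "(i, j) \<in> N" using i by (auto simp: N_def)
      then show False using image_eqI[of i fst "(i, j)" N] i by simp
    qed
    then show ?thesis using M' i \<open>I \<subseteq> I'\<close> by blast
  qed
  moreover have "half_persistence (b j) \<le> ereal f" if j: "j \<in> J - snd ` N" for j
  proof (cases "j \<in> snd ` M'")
    case True
    then obtain i where i: "(i, j) \<in> M'" by force
    have "i \<notin> I"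
    proof
      assume "i \<in> I"
      then have "(i, j) \<in> N" using i by (simp add: N_def)
      then show False using image_eqI[of j snd "(i, j)" N] j by simp
    qed
    then have "i \<in> I' - I" using i M' by blast
    moreover have "point_dist (a i) (b j) \<le> ereal f" using M' i by blast
    ultimately have "half_persistence (b j) \<le> ereal (e + f)"
      using half_persistence_lipschitz small by blast
    then show ?thesis using gap j by blast
  qed (use M' j in blast)
  moreover have "inj_on fst N"
    by (rule inj_on_subset[OF _ N]) (use M' in simp)
  moreover have "inj_on snd N"
    by (rule inj_on_subset[OF _ N]) (use M' in simp)
  moreover have "N \<subseteq> I \<times> J" using M' by (auto simp: N_def)
  ultimately have "is_matching I a J b (ereal f) N"
    using M' N unfolding is_matching_def by blast
  from bottleneck_le_of_matching[OF I J this] show "g \<le> f"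
    using g \<open>0 \<le> f\<close> by simp
qed

text \<open>
  The bars of \<open>Q_map m n x\<close> as one family over \<open>{..<m + n}\<close>. The infinite bar with index \<open>i \<ge> m\<close>
  uses the coordinate \<open>2 * m + (i - m) = m + i\<close>.
\<close>

definition bar_point :: "nat \<Rightarrow> (nat \<Rightarrow> real) \<Rightarrow> nat \<Rightarrow> point" where
  "bar_point m x i = (if i < m then (x (2 * i), ereal (x (2 * i + 1))) else (x (m + i), \<infinity>))"

lemma Q_map_eq_barcode_on: "Q_map m n x = barcode_on {..<m + n} (bar_point m x)"
proof -
  have "mset_set {..<m + n} = mset_set {..<m} + mset_set ((+) m ` {..<n})"
  proof -
    have "(+) m ` {..<n} = {m..<m + n}"
      using image_add_atLeastLessThan[of m 0 n] by (simp add: lessThan_atLeast0 add.commute)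
    then have "{..<m + n} = {..<m} \<union> (+) m ` {..<n}" by auto
    moreover have "{..<m} \<inter> (+) m ` {..<n} = {}" by auto
    ultimately show ?thesis by (simp add: mset_set_Union)
  qed
  also have "mset_set ((+) m ` {..<n}) = image_mset ((+) m) (mset_set {..<n})"
    by (simp add: image_mset_mset_set)
  finally have "image_mset (bar_point m x) (mset_set {..<m + n}) =
      image_mset (bar_point m x) (mset_set {..<m}) +
      image_mset (\<lambda>j. bar_point m x (m + j)) (mset_set {..<n})"
    by (simp add: multiset.map_comp comp_def)
  also have "image_mset (bar_point m x) (mset_set {..<m}) =
      image_mset (\<lambda>i. (x (2 * i), ereal (x (2 * i + 1)))) (mset_set {..<m})"
    by (rule image_mset_cong) (simp add: bar_point_def)
  also have "image_mset (\<lambda>j. bar_point m x (m + j)) (mset_set {..<n}) =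
      image_mset (\<lambda>j. (x (2 * m + j), \<infinity>)) (mset_set {..<n})"
    by (rule image_mset_cong) (simp add: bar_point_def mult_2 add.assoc)
  finally show ?thesis
    by (simp add: Q_map_def barcode_on_def)
qed

lemma barcode_on_in_Bar:
  assumes "finite I" "\<And>i. i \<in> I \<Longrightarrow> snd (a i) \<noteq> -\<infinity>"
  shows "barcode_on I a \<in> Bar"
  unfolding Bar_def barcode_on_def using assms
  by (intro CollectI exI[of _ "image_mset a (mset_set I)"]) auto

lemma Q_map_in_Bar_n: "Q_map m n x \<in> Bar_n n"
proof -
  have "Q_map m n x \<in> Bar"
    unfolding Q_map_eq_barcode_on by (rule barcode_on_in_Bar) (auto simp: bar_point_def)
  moreover have "num_infinite_bars (Q_map m n x) = n"
  proof -
    have "{i \<in> {..<m + n}. snd (bar_point m x i) = \<infinity>} = {m..<m + n}"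
      by (auto simp: bar_point_def)
    then show ?thesis
      unfolding Q_map_eq_barcode_on by (simp add: num_infinite_bars_barcode_on)
  qed
  ultimately show ?thesis by (simp add: Bar_n_def)
qed

lemma Bar_n_imp_Q_map:
  assumes "D \<in> Bar_n n"
  obtains m x where "D = Q_map m n x"
proof -
  obtain A where A: "D = barcode_of A" "\<And>p. p \<in># A \<Longrightarrow> snd p \<noteq> -\<infinity>"
    using assms by (auto simp: Bar_n_def Bar_def)
  define B where "B = filter_mset (\<lambda>p. snd p \<noteq> \<infinity>) A"
  define C where "C = filter_mset (\<lambda>p. snd p = \<infinity>) A"
  obtain ps where ps: "mset ps = B" using ex_mset by blast
  obtain qs where qs: "mset qs = C" using ex_mset by blast
  define m where "m = length ps"
  define l where "l = length qs"
  define x where "x k = (if k < 2 * m then if even k then fst (ps ! (k div 2))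
      else real_of_ereal (snd (ps ! (k div 2))) else fst (qs ! (k - 2 * m)))" for k
  have mset_nth: "mset zs = image_mset (\<lambda>i. zs ! i) (mset_set {..<length zs})" for zs :: "point list"
  proof -
    have "mset zs = mset (map ((!) zs) [0..<length zs])" by (simp add: map_nth)
    then show ?thesis by (simp add: mset_map atLeast0LessThan del: map_nth)
  qed
  have "image_mset (\<lambda>i. (x (2 * i), ereal (x (2 * i + 1)))) (mset_set {..<m}) = B"
    unfolding ps[symmetric] mset_nth[of ps] m_def[symmetric]
  proof (rule image_mset_cong)
    fix i assume i: "i \<in># mset_set {..<m}"
    then have "ps ! i \<in># B" by (simp add: m_def flip: ps)
    then have "\<bar>snd (ps ! i)\<bar> \<noteq> \<infinity>" using A(2)[of "ps ! i"] by (auto simp: B_def)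
    then show "(x (2 * i), ereal (x (2 * i + 1))) = ps ! i"
      using i by (simp add: x_def ereal_real' prod_eq_iff)
  qed
  moreover have "image_mset (\<lambda>j. (x (2 * m + j), \<infinity>)) (mset_set {..<l}) = C"
    unfolding qs[symmetric] mset_nth[of qs] l_def[symmetric]
  proof (rule image_mset_cong)
    fix i assume "i \<in># mset_set {..<l}"
    then have "qs ! i \<in># C" by (simp add: l_def flip: qs)
    then have "snd (qs ! i) = \<infinity>" by (simp add: C_def)
    then show "(x (2 * m + i), \<infinity>) = qs ! i"
      by (simp add: x_def prod_eq_iff)
  qed
  moreover have "B + C = A"
    unfolding B_def C_def using multiset_partition[of A "\<lambda>p. snd p \<noteq> \<infinity>"] by simp
  ultimately have "D = Q_map m l x"
    by (simp add: Q_map_def A(1))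
  moreover from this have "l = n"
    using Q_map_in_Bar_n[of m l x] assms by (simp add: Bar_n_def)
  ultimately show ?thesis using that by blast
qed

text \<open>
  Matching the infinite bars in the order of their indices, and no others, has finite cost.
\<close>

lemma bottleneck_Bar_n_finite:
  assumes "D \<in> Bar_n n" "D' \<in> Bar_n n"
  obtains f where "bottleneck D D' = ereal f" "0 \<le> f"
proof -
  obtain m x where D: "D = Q_map m n x" using Bar_n_imp_Q_map[OF assms(1)] by blast
  obtain m' x' where D': "D' = Q_map m' n x'" using Bar_n_imp_Q_map[OF assms(2)] by blast
  \<comment> \<open>a crude common bound for all the costs of the matching below\<close>
  define c where "c = (\<Sum>i<m. \<bar>x (2 * i + 1) - x (2 * i)\<bar>) + (\<Sum>i<m'. \<bar>x' (2 * i + 1) - x' (2 * i)\<bar>)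
     + (\<Sum>j<n. \<bar>x (2 * m + j) - x' (2 * m' + j)\<bar>)"
  have nonneg: "0 \<le> (\<Sum>i<m. \<bar>x (2 * i + 1) - x (2 * i)\<bar>)"
    "0 \<le> (\<Sum>i<m'. \<bar>x' (2 * i + 1) - x' (2 * i)\<bar>)"
    "0 \<le> (\<Sum>j<n. \<bar>x (2 * m + j) - x' (2 * m' + j)\<bar>)"
    by (auto intro: sum_nonneg)
  have 1: "\<bar>x (2 * i + 1) - x (2 * i)\<bar> \<le> c" if "i < m" for i
  proof -
    have "\<bar>x (2 * i + 1) - x (2 * i)\<bar> \<le> sum (\<lambda>i. \<bar>x (2 * i + 1) - x (2 * i)\<bar>) {..<m}"
      by (rule member_le_sum) (use that in simp_all)
    then show ?thesis unfolding c_def using nonneg by linarith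
  qed
  have 2: "\<bar>x' (2 * i + 1) - x' (2 * i)\<bar> \<le> c" if "i < m'" for i
  proof -
    have "\<bar>x' (2 * i + 1) - x' (2 * i)\<bar> \<le> sum (\<lambda>i. \<bar>x' (2 * i + 1) - x' (2 * i)\<bar>) {..<m'}"
      by (rule member_le_sum) (use that in simp_all)
    then show ?thesis unfolding c_def using nonneg by linarith
  qed
  have 3: "\<bar>x (2 * m + j) - x' (2 * m' + j)\<bar> \<le> c" if "j < n" for j
  proof -
    have "\<bar>x (2 * m + j) - x' (2 * m' + j)\<bar> \<le> sum (\<lambda>j. \<bar>x (2 * m + j) - x' (2 * m' + j)\<bar>) {..<n}"
      by (rule member_le_sum) (use that in simp_all)
    then show ?thesis unfolding c_def using nonneg by linarith
  qed
  have "0 \<le> c" using nonneg by (simp add: c_def)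
  define M where "M = (\<lambda>j. (m + j, m' + j)) ` {..<n}"
  have "is_matching {..<m + n} (bar_point m x) {..<m' + n} (bar_point m' x') (ereal c) M"
    unfolding is_matching_def
  proof (intro conjI ballI)
    show "M \<subseteq> {..<m + n} \<times> {..<m' + n}" "inj_on fst M" "inj_on snd M"
      by (auto simp: M_def inj_on_def)
    fix p assume "p \<in> M"
    then show "case p of (i, j) \<Rightarrow> point_dist (bar_point m x i) (bar_point m' x' j) \<le> ereal c"
      using 3 by (auto simp: M_def point_dist_le_iff bar_point_def mult_2 add.assoc)
  next
    fix i assume i: "i \<in> {..<m + n} - fst ` M"
    have "i < m"
    proof (rule ccontr)
      assume "\<not> i < m"
      then have "(i, m' + (i - m)) \<in> M" 
        unfolding M_def using i by (intro image_eqI[of _ _ "i - m"]) auto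
      then have "i \<in> fst ` M" by (metis fst_conv imageI)
      then show False using i by blast
    qed
    then show "half_persistence (bar_point m x i) \<le> ereal c"
      using 1[of i] \<open>0 \<le> c\<close> by (simp add: bar_point_def half_persistence_le_iff)
  next
    fix i assume i: "i \<in> {..<m' + n} - snd ` M"
    have "i < m'"
    proof (rule ccontr)
      assume "\<not> i < m'"
      then have "(m + (i - m'), i) \<in> M" 
        unfolding M_def using i by (intro image_eqI[of _ _ "i - m'"]) auto
      then have "i \<in> snd ` M" by (metis snd_conv imageI)
      then show False using i by blast
    qed
    then show "half_persistence (bar_point m' x' i) \<le> ereal c"
      using 2[of i] \<open>0 \<le> c\<close> by (simp add: bar_point_def half_persistence_le_iff)
  qed
  from bottleneck_le_of_matching[OF _ _ this] have le: "bottleneck D D' \<le> ereal c"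
    using \<open>0 \<le> c\<close> by (simp add: D D' Q_map_eq_barcode_on)
  have "(diag 0, 0) \<in> copies D"
    by (simp add: copies_def D Q_map_eq_barcode_on barcode_on_apply zero_ereal_def)
  then have "0 \<le> bottleneck D D'" using bottleneck_nonneg by blast
  with le show ?thesis using that by (cases "bottleneck D D'") auto
qed

lemma bottleneck_eq_dist_to:
  assumes "D \<in> Bar_n n" "D0 \<in> Bar_n n"
  shows "bottleneck D D0 = ereal (dist_to D0 D)" and "0 \<le> dist_to D0 D"
  using bottleneck_Bar_n_finite[OF assms] by (metis dist_to_def real_of_ereal.simps(1))+

lemma dist_to_lipschitz:
  assumes "D \<in> Bar_n n" "D' \<in> Bar_n n" "D0 \<in> Bar_n n" "bottleneck D D' \<le> ereal c"
  shows "\<bar>dist_to D0 D - dist_to D0 D'\<bar> \<le> c"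
proof -
  note eq = bottleneck_eq_dist_to(1)[OF assms(1,3)] bottleneck_eq_dist_to(1)[OF assms(2,3)]
  have "bottleneck D D0 \<le> ereal (c + dist_to D0 D')"
    by (rule bottleneck_triangle[OF assms(4)]) (simp add: eq)
  moreover have "bottleneck D' D0 \<le> ereal (c + dist_to D0 D)"
    by (rule bottleneck_triangle[of D' D]) (use assms(4) in \<open>simp_all add: eq bottleneck_commute\<close>)
  ultimately show ?thesis by (simp add: eq abs_le_iff)
qed

lemma bottleneck_Q_map_le:
  assumes "0 \<le> c" "\<And>k. k < 2 * m + n \<Longrightarrow> \<bar>y k - z k\<bar> \<le> c"
  shows "bottleneck (Q_map m n y) (Q_map m n z) \<le> ereal c"
  unfolding Q_map_eq_barcode_on
proof (rule bottleneck_barcode_on_same_index)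
  fix i assume "i \<in> {..<m + n}"
  then show "point_dist (bar_point m y i) (bar_point m z i) \<le> ereal c"
    using assms(2)[of "2 * i"] assms(2)[of "2 * i + 1"] assms(2)[of "m + i"]
    by (auto simp: bar_point_def point_dist_le_iff)
qed (use assms in auto)

text \<open>
  All points of \<open>D\<close>, including the diagonal points that are matched with bars of \<open>D0\<close>, move
  linearly towards their partners in an optimal matching. The interpolated barcode is within
  \<open>t * f\<close> of one end and within \<open>(1 - t) * f\<close> of the other, and by the triangle inequality the
  second bound is an equality.
\<close>

lemma bottleneck_geodesic:
  assumes D: "D \<in> Bar_n n" and D0: "D0 \<in> Bar_n n" and t: "0 \<le> t" "t \<le> 1"
  obtains D1 where "D1 \<in> Bar_n n" "bottleneck D D1 \<le> ereal (t * dist_to D0 D)"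
    "dist_to D0 D1 = (1 - t) * dist_to D0 D"
proof -
  define f where "f = dist_to D0 D"
  have f: "bottleneck D D0 = ereal f" "0 \<le> f"
    unfolding f_def using bottleneck_eq_dist_to[OF D D0] by auto
  obtain m x where Q: "D = Q_map m n x" using Bar_n_imp_Q_map[OF D] by blast
  obtain m' x' where Q': "D0 = Q_map m' n x'" using Bar_n_imp_Q_map[OF D0] by blast
  obtain M where "is_matching {..<m + n} (bar_point m x) {..<m' + n} (bar_point m' x') (ereal f) M"
    using bottleneck_barcode_on_attained(2)[of "{..<m + n}" "{..<m' + n}"] f(1)
    unfolding Q Q' Q_map_eq_barcode_on by blast
  then obtain K :: "(nat + nat) set" and a b where K: "finite K"
    and a: "barcode_on K a = D" and b: "barcode_on K b = D0"
    and ab: "\<And>k. k \<in> K \<Longrightarrow> point_dist (a k) (b k) \<le> ereal f"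
    using matching_padding[of "{..<m + n}" "{..<m' + n}"]
    unfolding Q Q' Q_map_eq_barcode_on by blast
  define c where "c k = ((1 - t) * fst (a k) + t * fst (b k), if snd (a k) = \<infinity> then \<infinity>
      else ereal ((1 - t) * real_of_ereal (snd (a k)) + t * real_of_ereal (snd (b k))))" for k
  have finite: "snd (a k) \<noteq> -\<infinity>" if "k \<in> K" for k
  proof
    assume k: "snd (a k) = -\<infinity>"
    then have "a k \<notin> range diag" by auto
    then have "D (a k) = enat (card {i \<in> K. a i = a k})"
      by (simp add: barcode_on_apply K flip: a)
    moreover have "D (a k) = enat (card {i \<in> {..<m + n}. bar_point m x i = a k})"
      using \<open>a k \<notin> range diag\<close> by (simp add: Q Q_map_eq_barcode_on barcode_on_apply)
    moreover have "{i \<in> {..<m + n}. bar_point m x i = a k} = {}"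
      using k by (auto simp: bar_point_def dest!: arg_cong[of _ _ snd] split: if_splits)
    ultimately have "card {i \<in> K. a i = a k} = 0" by (simp only: card.empty enat.inject)
    then show False using that K by (auto simp: card_eq_0_iff)
  qed
  have scale: "\<bar>u - ((1 - t) * u + t * v)\<bar> \<le> t * f" "\<bar>((1 - t) * u + t * v) - v\<bar> \<le> (1 - t) * f"
    if "\<bar>u - v\<bar> \<le> f" for u v :: real
  proof -
    have "u - ((1 - t) * u + t * v) = t * (u - v)" "((1 - t) * u + t * v) - v = (1 - t) * (u - v)"
      by (simp_all add: algebra_simps)
    then show "\<bar>u - ((1 - t) * u + t * v)\<bar> \<le> t * f" "\<bar>((1 - t) * u + t * v) - v\<bar> \<le> (1 - t) * f"
      using that t by (simp_all only: abs_mult) (simp_all add: mult_left_mono)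
  qed
  have dist: "point_dist (a k) (c k) \<le> ereal (t * f) \<and> point_dist (c k) (b k) \<le> ereal ((1 - t) * f)"
    if k: "k \<in> K" for k
  proof -
    have fst: "\<bar>fst (a k) - fst (b k)\<bar> \<le> f" using ab[OF k] by (simp add: point_dist_le_iff)
    show ?thesis
    proof (cases "snd (a k) = \<infinity>")
      case True
      then have "snd (b k) = \<infinity>" using ab[OF k] by (auto simp: point_dist_le_iff)
      then show ?thesis using True scale[OF fst] by (simp add: point_dist_le_iff c_def)
    next
      case False
      then obtain d where d: "snd (a k) = ereal d" using finite[OF k] by (cases "snd (a k)") auto
      then obtain d' where d': "snd (b k) = ereal d'" "\<bar>d - d'\<bar> \<le> f"
        using ab[OF k] f(2) unfolding point_dist_le_iff by (metis abs_zero diff_self ereal.inject)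
      show ?thesis using d d'(1) scale[OF fst] scale[OF d'(2)] by (simp add: point_dist_le_iff c_def)
    qed
  qed
  have C: "barcode_on K c \<in> Bar_n n"
  proof -
    have "barcode_on K c \<in> Bar" by (rule barcode_on_in_Bar[OF K]) (simp add: c_def)
    moreover have "{k \<in> K. snd (c k) = \<infinity>} = {k \<in> K. snd (a k) = \<infinity>}" by (auto simp: c_def)
    then have "num_infinite_bars (barcode_on K c) = num_infinite_bars D"
      unfolding a[symmetric] num_infinite_bars_barcode_on[OF K] by simp
    ultimately show ?thesis using D by (simp add: Bar_n_def)
  qed
  have 1: "bottleneck D (barcode_on K c) \<le> ereal (t * f)"
    unfolding a[symmetric] by (rule bottleneck_barcode_on_same_index[OF K]) (use dist t f(2) in auto)
  have "bottleneck (barcode_on K c) D0 \<le> ereal ((1 - t) * f)"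
    unfolding b[symmetric] by (rule bottleneck_barcode_on_same_index[OF K]) (use dist t f(2) in auto)
  then have "dist_to D0 (barcode_on K c) \<le> (1 - t) * f"
    by (simp add: bottleneck_eq_dist_to(1)[OF C D0])
  moreover have "(1 - t) * f \<le> dist_to D0 (barcode_on K c)"
    using dist_to_lipschitz[OF D C D0 1] by (simp add: f_def algebra_simps)
  ultimately show ?thesis using that[OF C] 1 by (simp add: f_def)
qed

section \<open>Locally affine functions\<close>

text \<open>
  The pair \<open>(c, L)\<close> stands for the affine function with constant term \<open>c\<close> and linear
  coefficients \<open>L\<close>. With coefficients as data, distinct functions are distinct pairs and gradients
  can be read off.
\<close>

definition affine_eval :: "nat \<Rightarrow> real \<times> (nat \<Rightarrow> real) \<Rightarrow> (nat \<Rightarrow> real) \<Rightarrow> real" where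
  "affine_eval N A x = fst A + (\<Sum>k<N. snd A k * x k)"

lemma continuous_map_coordinate: "continuous_map (Euclidean_space N) euclideanreal (\<lambda>x. x k)"
  unfolding Euclidean_space_def
  by (intro continuous_map_from_subtopology continuous_map_product_projection) simp

lemma continuous_map_affine_eval: "continuous_map (Euclidean_space N) euclideanreal (affine_eval N A)"
  unfolding affine_eval_def
  by (intro continuous_map_add continuous_map_sum continuous_map_real_mult
      continuous_map_coordinate) auto

lemma open_coordinate_line:
  assumes U: "openin (Euclidean_space N) U" and x: "x \<in> U" and "i < N"
  shows "open {t. x(i := t) \<in> U}"
proof -
  have "x \<in> topspace (Euclidean_space N)" using openin_subset[OF U] x by blast
  then have zero: "x j = 0" if "N \<le> j" for j
    using that by (simp add: topspace_Euclidean_space)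
  have "continuous_map euclideanreal (Euclidean_space N) (\<lambda>t. x(i := t))"
    unfolding Euclidean_space_def continuous_map_in_subtopology continuous_map_componentwise_UNIV
    using zero \<open>i < N\<close> by (auto simp: fun_upd_def)
  from openin_continuous_map_preimage[OF this U] show ?thesis by simp
qed

lemma has_derivative_locally_affine:
  assumes U: "openin (Euclidean_space N) U" and x: "x \<in> U" and i: "i < N"
    and f: "\<And>y. y \<in> U \<Longrightarrow> f y = affine_eval N A y"
  shows "((\<lambda>t. f (x(i := t))) has_field_derivative snd A i) (at (x i))"
proof (rule has_field_derivative_transform_within_open[OF _ open_coordinate_line[OF U x i]])
  have upd: "affine_eval N A (x(i := t)) = affine_eval N A x + snd A i * (t - x i)" for t
  proof -
    have "(\<Sum>k<N. snd A k * (x(i := t)) k) = (\<Sum>k<N. snd A k * x k + (if k = i then snd A i * (t - x i) else 0))"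
      by (rule sum.cong) (auto simp: algebra_simps)
    also have "\<dots> = (\<Sum>k<N. snd A k * x k) + snd A i * (t - x i)"
      using i by (simp add: sum.distrib)
    finally show ?thesis by (simp add: affine_eval_def)
  qed
  show "((\<lambda>t. affine_eval N A x + snd A i * (t - x i)) has_field_derivative snd A i) (at (x i))"
    by (auto intro!: derivative_eq_intros)
  show "affine_eval N A x + snd A i * (t - x i) = f (x(i := t))" if "t \<in> {t. x(i := t) \<in> U}" for t
    using f that upd by simp
qed (use x in simp)

lemma partial_deriv_locally_affine:
  assumes "openin (Euclidean_space N) U" "x \<in> U" "i < N" "\<And>y. y \<in> U \<Longrightarrow> f y = affine_eval N A y"
  shows "partial_deriv i f x = snd A i"
  unfolding partial_deriv_def by (rule DERIV_imp_deriv[OF has_derivative_locally_affine[OF assms]])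

text \<open>
  The partial derivatives are constant on \<open>U\<close> and so again locally affine, which carries the
  induction.
\<close>

lemma Ck_on_locally_affine:
  assumes U: "openin (Euclidean_space N) U" and f: "\<And>y. y \<in> U \<Longrightarrow> f y = affine_eval N A y"
  shows "Ck_on N k f U"
  using f
proof (induction k arbitrary: f A)
  case (0 f A)
  have "continuous_map (subtopology (Euclidean_space N) U) euclideanreal f"
    by (rule continuous_map_eq[OF continuous_map_from_subtopology[OF continuous_map_affine_eval]])
      (use 0 in simp)
  then show ?case by simp
next
  case (Suc k f A)
  have "continuous_map (subtopology (Euclidean_space N) U) euclideanreal f"
    by (rule continuous_map_eq[OF continuous_map_from_subtopology[OF continuous_map_affine_eval]])
      (use Suc.prems in simp)
  moreover have "(\<lambda>t. f (x(i := t))) differentiable at (x i)" if "i < N" "x \<in> U" for i x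
    using has_derivative_locally_affine[OF U that(2,1) Suc.prems] real_differentiable_def by blast
  moreover have "Ck_on N k (partial_deriv i f) U" if "i < N" for i
    by (rule Suc.IH[of _ "(snd A i, \<lambda>_. 0)"])
      (simp add: affine_eval_def partial_deriv_locally_affine[OF U _ that Suc.prems])
  ultimately show ?case by simp
qed

lemma Cinf_on_locally_affine:
  assumes "openin (Euclidean_space N) U" "\<And>y. y \<in> U \<Longrightarrow> f y = affine_eval N A y"
  shows "Cinf_on N f U"
  unfolding Cinf_on_def using Ck_on_locally_affine[OF assms] by blast

lemma openin_sup_ball:
  "openin (Euclidean_space N) {y \<in> topspace (Euclidean_space N). \<forall>k<N. \<bar>y k - x k\<bar> < \<delta>}"
proof -
  have eq: "{y \<in> topspace (Euclidean_space N). \<forall>k<N. \<bar>y k - x k\<bar> < \<delta>} =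
      topspace (Euclidean_space N) \<inter> (\<Inter>k<N. {y \<in> topspace (Euclidean_space N). y k \<in> ball (x k) \<delta>})"
    by (auto simp: dist_real_def abs_minus_commute)
  have "openin (Euclidean_space N) {y \<in> topspace (Euclidean_space N). y k \<in> ball (x k) \<delta>}" for k
    by (rule openin_continuous_map_preimage[OF continuous_map_coordinate]) simp
  then show ?thesis
    unfolding eq by (cases "N = 0") (auto intro!: openin_Int openin_INT2)
qed

text \<open>
  The composition of an affine function of \<open>N\<close> variables with the substitution \<open>y \<mapsto> y \<circ> \<tau>\<close>, for
  injective \<open>\<tau>\<close>.
\<close>

definition pullback_affine :: "nat \<Rightarrow> (nat \<Rightarrow> nat) \<Rightarrow> real \<times> (nat \<Rightarrow> real) \<Rightarrow> real \<times> (nat \<Rightarrow> real)" where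
  "pullback_affine N \<tau> A =
     (fst A, \<lambda>j. if j \<in> \<tau> ` {..<N} then snd A (inv_into {..<N} \<tau> j) else 0)"

context
  fixes N N' :: nat and \<tau> :: "nat \<Rightarrow> nat"
  assumes inj: "inj_on \<tau> {..<N}" and range: "\<tau> ` {..<N} \<subseteq> {..<N'}"
begin

lemma snd_pullback_affine: "k < N \<Longrightarrow> snd (pullback_affine N \<tau> A) (\<tau> k) = snd A k"
  using inj by (simp add: pullback_affine_def inv_into_f_f)

lemma affine_eval_pullback: "affine_eval N' (pullback_affine N \<tau> A) y = affine_eval N A (y \<circ> \<tau>)"
proof -
  have "(\<Sum>j<N'. snd (pullback_affine N \<tau> A) j * y j) =
      (\<Sum>j\<in>\<tau> ` {..<N}. snd (pullback_affine N \<tau> A) j * y j)"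
    by (rule sum.mono_neutral_right) (use range in \<open>auto simp: pullback_affine_def\<close>)
  also have "\<dots> = (\<Sum>k<N. snd A k * y (\<tau> k))"
    by (simp add: sum.reindex[OF inj] snd_pullback_affine)
  finally show ?thesis by (simp add: affine_eval_def pullback_affine_def)
qed

lemma pullback_affine_support:
  "{j. j < N' \<and> snd (pullback_affine N \<tau> A) j \<noteq> 0} = \<tau> ` {k. k < N \<and> snd A k \<noteq> 0}"
proof (intro set_eqI iffI)
  fix j assume j: "j \<in> {j. j < N' \<and> snd (pullback_affine N \<tau> A) j \<noteq> 0}"
  then have "j \<in> \<tau> ` {..<N}" by (auto simp: pullback_affine_def split: if_splits)
  then obtain k where "k < N" "j = \<tau> k" by blast
  then show "j \<in> \<tau> ` {k. k < N \<and> snd A k \<noteq> 0}" using j by (simp add: snd_pullback_affine)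
qed (use range in \<open>auto simp: snd_pullback_affine\<close>)

lemma one_unit_component_pullback:
  assumes "one_unit_component N (snd A)"
  shows "one_unit_component N' (snd (pullback_affine N \<tau> A))"
proof -
  obtain i where i: "{k. k < N \<and> snd A k \<noteq> 0} = {i}" "snd A i = 1 \<or> snd A i = - 1"
    using assms by (auto simp: one_unit_component_def)
  then have "i < N" by blast
  then show ?thesis
    unfolding one_unit_component_def pullback_affine_support i(1)
    using i(2) by (intro exI[of _ "\<tau> i"]) (simp add: snd_pullback_affine)
qed

lemma two_half_components_pullback:
  assumes "two_half_components N (snd A)"
  shows "two_half_components N' (snd (pullback_affine N \<tau> A))"
proof -
  obtain i j where ij: "i \<noteq> j" "{k. k < N \<and> snd A k \<noteq> 0} = {i, j}" "snd A i = 1 / 2" "snd A j = - 1 / 2"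
    using assms unfolding two_half_components_def by blast
  then have "i < N" "j < N" by blast+
  then show ?thesis
    unfolding two_half_components_def pullback_affine_support ij(2)
    using ij inj by (intro exI[of _ "\<tau> i"] exI[of _ "\<tau> j"]) (simp add: snd_pullback_affine inj_on_eq_iff)
qed

end

lemma not_one_unit_and_two_half: "\<not> (one_unit_component N g \<and> two_half_components N g)"
proof
  assume *: "one_unit_component N g \<and> two_half_components N g"
  then obtain i where "{k. k < N \<and> g k \<noteq> 0} = {i}" by (auto simp: one_unit_component_def)
  moreover obtain j l where "j \<noteq> l" "{k. k < N \<and> g k \<noteq> 0} = {j, l}"
    using * unfolding two_half_components_def by blast
  ultimately show False by auto
qed

text \<open>
  Along the curve \<open>x k + s ^ (k + 1)\<close> the difference of two affine functions is a polynomial in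
  \<open>s\<close> whose non-constant coefficients are the differences of their linear coefficients. It is
  nonzero when the functions differ, so all but finitely many \<open>s\<close> separate all the functions.
\<close>

lemma generic_point_separates_affine:
  fixes x :: "nat \<Rightarrow> real"
  assumes fin: "finite \<A>" and supp: "\<And>A k. A \<in> \<A> \<Longrightarrow> N \<le> k \<Longrightarrow> snd A k = 0" and "0 < e"
  obtains z where "\<And>k. \<bar>z k - x k\<bar> < e"
    "\<And>A B. A \<in> \<A> \<Longrightarrow> B \<in> \<A> \<Longrightarrow> A \<noteq> B \<Longrightarrow> affine_eval N A z \<noteq> affine_eval N B z"
proof -
  define p where "p A B = [:affine_eval N A x - affine_eval N B x:] +
    (\<Sum>k<N. monom (snd A k - snd B k) (Suc k))" for A B
  have poly: "poly (p A B) s =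
      affine_eval N A (\<lambda>k. x k + s ^ Suc k) - affine_eval N B (\<lambda>k. x k + s ^ Suc k)" for A B s
    by (simp add: p_def poly_sum poly_monom affine_eval_def algebra_simps sum.distrib sum_subtractf)
  have coeff: "coeff (p A B) (Suc k) = snd A k - snd B k" if "k < N" for A B k
    using that by (simp add: p_def coeff_sum)
  have coeff0: "coeff (p A B) 0 = affine_eval N A x - affine_eval N B x" for A B
    by (simp add: p_def coeff_sum)
  have nonzero: "p A B \<noteq> 0" if "A \<in> \<A>" "B \<in> \<A>" "A \<noteq> B" for A B
  proof
    assume "p A B = 0"
    then have "snd A k = snd B k" for k
      using coeff[of k A B] supp[OF that(1), of k] supp[OF that(2), of k] by (cases "k < N") auto
    then have "snd A = snd B" by blast
    moreover have "fst A = fst B"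
      using coeff0[of A B] \<open>p A B = 0\<close> \<open>snd A = snd B\<close> by (simp add: affine_eval_def)
    ultimately show False using \<open>A \<noteq> B\<close> by (simp add: prod_eq_iff)
  qed
  define Z where "Z = (\<Union>A\<in>\<A>. \<Union>B\<in>\<A> - {A}. {s. poly (p A B) s = 0})"
  have "finite Z"
    unfolding Z_def using fin nonzero by (intro finite_UN_I finite_Diff poly_roots_finite) auto
  moreover have "infinite {0<..<min e 1}" using \<open>0 < e\<close> by simp
  ultimately obtain s where s: "s \<in> {0<..<min e 1}" "s \<notin> Z"
    by (metis finite_subset subsetI)
  show ?thesis
  proof (rule that)
    fix k
    have "s ^ Suc k \<le> s" using s(1) power_le_one[of s k] by (simp add: mult_left_le)
    moreover have "0 \<le> s ^ Suc k" using s(1) by simp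
    ultimately show "\<bar>(x k + s ^ Suc k) - x k\<bar> < e" using s(1) by (simp del: power_Suc)
  next
    fix A B assume "A \<in> \<A>" "B \<in> \<A>" "A \<noteq> B"
    then have "poly (p A B) s \<noteq> 0" using s(2) by (auto simp: Z_def)
    then show "affine_eval N A (\<lambda>k. x k + s ^ Suc k) \<noteq> affine_eval N B (\<lambda>k. x k + s ^ Suc k)"
      unfolding poly by simp
  qed
qed

section \<open>The bottleneck distance as a selection of affine functions\<close>

definition coordinate_cost :: "real \<Rightarrow> nat \<Rightarrow> real \<Rightarrow> real \<times> (nat \<Rightarrow> real)" where
  "coordinate_cost s k r = (- s * r, \<lambda>j. if j = k then s else 0)"

definition persistence_cost :: "real \<Rightarrow> nat \<Rightarrow> real \<times> (nat \<Rightarrow> real)" where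
  "persistence_cost s i =
     (0, \<lambda>j. if j = 2 * i + 1 then s / 2 else if j = 2 * i then - s / 2 else 0)"

text \<open>
  The possible costs that vary with the parametrisation, with both signs so that absolute values
  need not be written; here \<open>R\<close> is the set of coordinates of the other barcode.
\<close>

definition affine_costs :: "nat \<Rightarrow> nat \<Rightarrow> real set \<Rightarrow> (real \<times> (nat \<Rightarrow> real)) set" where
  "affine_costs m n R =
     (\<lambda>(s, k, r). coordinate_cost s k r) ` ({1, -1} \<times> {..<2 * m + n} \<times> R) \<union>
     (\<lambda>(s, i). persistence_cost s i) ` ({1, -1} \<times> {..<m})"

lemma affine_costs_cases:
  assumes "A \<in> affine_costs m n R"
  obtains (coordinate) s k r where "s = 1 \<or> s = -1" "k < 2 * m + n" "r \<in> R"
      "A = coordinate_cost s k r"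
  | (persistence) s i where "s = 1 \<or> s = -1" "i < m" "A = persistence_cost s i"
proof -
  consider p where "p \<in> {1, -1} \<times> {..<2 * m + n} \<times> R" "A = coordinate_cost (fst p) (fst (snd p)) (snd (snd p))"
    | p where "p \<in> {1, -1} \<times> {..<m}" "A = persistence_cost (fst p) (snd p)"
    using assms unfolding affine_costs_def by (elim UnE imageE) (auto simp: case_prod_beta)
  then show ?thesis
  proof cases
    case (1 p)
    show ?thesis by (rule coordinate[of "fst p" "fst (snd p)" "snd (snd p)"]) (use 1 in auto)
  next
    case (2 p)
    show ?thesis by (rule persistence[of "fst p" "snd p"]) (use 2 in auto)
  qed
qed

lemma coordinate_in_affine_costs:
  "s = 1 \<or> s = -1 \<Longrightarrow> k < 2 * m + n \<Longrightarrow> r \<in> R \<Longrightarrow> coordinate_cost s k r \<in> affine_costs m n R"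
  unfolding affine_costs_def by (intro UnI1 image_eqI[of _ _ "(s, k, r)"]) auto

lemma persistence_in_affine_costs:
  "s = 1 \<or> s = -1 \<Longrightarrow> i < m \<Longrightarrow> persistence_cost s i \<in> affine_costs m n R"
  unfolding affine_costs_def by (intro UnI2 image_eqI[of _ _ "(s, i)"]) auto

lemma finite_affine_costs: "finite R \<Longrightarrow> finite (affine_costs m n R)"
  unfolding affine_costs_def by simp

lemma affine_costs_support: "A \<in> affine_costs m n R \<Longrightarrow> 2 * m + n \<le> k \<Longrightarrow> snd A k = 0"
  by (erule affine_costs_cases) (auto simp: coordinate_cost_def persistence_cost_def)

lemma affine_eval_coordinate:
  assumes "k < N"
  shows "affine_eval N (coordinate_cost s k r) x = s * (x k - r)"
proof -
  have "(\<Sum>j<N. (if j = k then s else 0) * x j) = (\<Sum>j<N. if j = k then s * x k else 0)"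
    by (rule sum.cong) auto
  then show ?thesis using assms by (simp add: affine_eval_def coordinate_cost_def algebra_simps)
qed

lemma affine_eval_persistence:
  assumes "2 * i + 1 < N"
  shows "affine_eval N (persistence_cost s i) x
    = s * (x (2 * i + 1) - x (2 * i)) / 2"
proof -
  have "(\<Sum>j<N. (if j = 2 * i + 1 then s / 2 else if j = 2 * i then - s / 2 else 0) * x j) =
      (\<Sum>j<N. (if j = 2 * i + 1 then s / 2 * x (2 * i + 1) else 0) +
        (if j = 2 * i then - s / 2 * x (2 * i) else 0))"
    by (rule sum.cong) auto
  also have "\<dots> = s / 2 * x (2 * i + 1) - s / 2 * x (2 * i)"
    using assms by (simp add: sum.distrib)
  finally show ?thesis by (simp add: affine_eval_def persistence_cost_def algebra_simps diff_divide_distrib)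
qed

lemma affine_costs_component:
  assumes "A \<in> affine_costs m n R"
  shows "one_unit_component (2 * m + n) (snd A) \<or> two_half_components (2 * m + n) (snd A)"
  using assms
proof (cases rule: affine_costs_cases)
  case (coordinate s k r)
  then have "{j. j < 2 * m + n \<and> snd A j \<noteq> 0} = {k}" by (auto simp: coordinate_cost_def)
  then show ?thesis using coordinate by (auto simp: one_unit_component_def coordinate_cost_def)
next
  case (persistence s i)
  then have supp: "{j. j < 2 * m + n \<and> snd A j \<noteq> 0} = {2 * i + 1, 2 * i}"
    by (auto simp: persistence_cost_def)
  have "two_half_components (2 * m + n) (snd A)"
    unfolding two_half_components_def supp
  proof (cases "s = 1")
    case True
    then show "\<exists>j l. j \<noteq> l \<and> {2 * i + 1, 2 * i} = {j, l} \<and> snd A j = 1 / 2 \<and> snd A l = - 1 / 2"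
      using persistence by (intro exI[of _ "2 * i + 1"] exI[of _ "2 * i"]) (simp add: persistence_cost_def)
  next
    case False
    then show "\<exists>j l. j \<noteq> l \<and> {2 * i + 1, 2 * i} = {j, l} \<and> snd A j = 1 / 2 \<and> snd A l = - 1 / 2"
      using persistence by (intro exI[of _ "2 * i"] exI[of _ "2 * i + 1"]) (auto simp: persistence_cost_def)
  qed
  then show ?thesis ..
qed

lemma affine_costs_lipschitz:
  assumes A: "A \<in> affine_costs m n R" and z: "\<And>k. k < 2 * m + n \<Longrightarrow> \<bar>z k - x k\<bar> \<le> e"
  shows "\<bar>affine_eval (2 * m + n) A z - affine_eval (2 * m + n) A x\<bar> \<le> e"
  using A
proof (cases rule: affine_costs_cases)
  case (coordinate s k r)
  have "affine_eval (2 * m + n) A z - affine_eval (2 * m + n) A x = s * (z k - x k)"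
    unfolding coordinate(4) affine_eval_coordinate[OF coordinate(2)] by (simp add: algebra_simps)
  moreover have "\<bar>s * (z k - x k)\<bar> = \<bar>z k - x k\<bar>"
    using coordinate(1) by (auto simp: abs_mult)
  ultimately show ?thesis using z[OF coordinate(2)] by simp
next
  case (persistence s i)
  have i: "2 * i + 1 < 2 * m + n" using persistence(2) by simp
  have "affine_eval (2 * m + n) A z - affine_eval (2 * m + n) A x =
      s * ((z (2 * i + 1) - x (2 * i + 1)) - (z (2 * i) - x (2 * i))) / 2"
    unfolding persistence(3) affine_eval_persistence[OF i] by (simp add: algebra_simps diff_divide_distrib add_divide_distrib)
  moreover have "\<bar>s * w / 2\<bar> = \<bar>w\<bar> / 2" for w
    using persistence(1) by (auto simp: abs_mult)
  moreover have "\<bar>z (2 * i + 1) - x (2 * i + 1)\<bar> \<le> e" "\<bar>z (2 * i) - x (2 * i)\<bar> \<le> e"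
    using i by (auto intro!: z)
  ultimately show ?thesis by (simp only:) argo
qed

lemma coordinate_cost_in_affine_costs:
  assumes "k < 2 * m + n" "r \<in> R"
  shows "\<bar>x k - r\<bar> \<in> (\<lambda>A. affine_eval (2 * m + n) A x) ` affine_costs m n R"
proof -
  define s :: real where "s = (if r \<le> x k then 1 else -1)"
  have "coordinate_cost s k r \<in> affine_costs m n R"
    using assms by (intro coordinate_in_affine_costs) (auto simp: s_def)
  moreover have "\<bar>x k - r\<bar> = affine_eval (2 * m + n) (coordinate_cost s k r) x"
    unfolding affine_eval_coordinate[OF assms(1)] by (simp add: s_def)
  ultimately show ?thesis by (rule rev_image_eqI)
qed

lemma persistence_cost_in_affine_costs:
  assumes "i < m"
  shows "\<bar>x (2 * i + 1) - x (2 * i)\<bar> / 2 \<in> (\<lambda>A. affine_eval (2 * m + n) A x) ` affine_costs m n R"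
proof -
  define s :: real where "s = (if x (2 * i) \<le> x (2 * i + 1) then 1 else -1)"
  let ?A = "persistence_cost s i"
  have i: "2 * i + 1 < 2 * m + n" using assms by simp
  have "?A \<in> affine_costs m n R"
    using assms by (intro persistence_in_affine_costs) (auto simp: s_def)
  moreover have "\<bar>x (2 * i + 1) - x (2 * i)\<bar> / 2 = affine_eval (2 * m + n) ?A x"
    unfolding affine_eval_persistence[OF i] by (simp add: s_def)
  ultimately show ?thesis by (rule rev_image_eqI)
qed

text \<open>
  Injectivity is on coefficient pairs. Since both signs of each cost are present, it also keeps
  every cost away from zero: the point has no bar on the diagonal and no coordinate in \<open>R\<close>.
\<close>

definition generic_point :: "nat \<Rightarrow> nat \<Rightarrow> real set \<Rightarrow> (nat \<Rightarrow> real) \<Rightarrow> bool" where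
  "generic_point m n R x \<longleftrightarrow> inj_on (\<lambda>A. affine_eval (2 * m + n) A x) (affine_costs m n R)"

lemma generic_point_exists:
  assumes "finite R" "0 < e"
  obtains z where "\<And>k. \<bar>z k - x k\<bar> < e" "generic_point m n R z"
proof -
  have supp: "\<And>A k. A \<in> affine_costs m n R \<Longrightarrow> 2 * m + n \<le> k \<Longrightarrow> snd A k = 0"
    by (rule affine_costs_support)
  obtain z where z: "\<And>k. \<bar>z k - x k\<bar> < e"
    "\<And>A B. A \<in> affine_costs m n R \<Longrightarrow> B \<in> affine_costs m n R \<Longrightarrow> A \<noteq> B \<Longrightarrow>
      affine_eval (2 * m + n) A z \<noteq> affine_eval (2 * m + n) B z"
    using generic_point_separates_affine[OF finite_affine_costs[OF assms(1)] supp assms(2), where x = x]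
    by blast
  have "generic_point m n R z"
    unfolding generic_point_def by (rule inj_onI, rule ccontr) (use z(2) in simp)
  with z(1) show ?thesis by (rule that)
qed

lemma generic_point_off_diagonal:
  assumes "generic_point m n R x" "i < m"
  shows "x (2 * i) \<noteq> x (2 * i + 1)"
proof
  assume eq: "x (2 * i) = x (2 * i + 1)"
  let ?A = "\<lambda>s. persistence_cost s i"
  have i: "2 * i + 1 < 2 * m + n" using assms by simp
  have "affine_eval (2 * m + n) (?A 1) x = affine_eval (2 * m + n) (?A (-1)) x"
    unfolding affine_eval_persistence[OF i] using eq by simp
  then have "?A 1 = ?A (-1)"
    by (rule inj_onD[OF assms(1)[unfolded generic_point_def]])
      (rule persistence_in_affine_costs, simp_all add: assms(2))+
  then have "snd (?A 1) (2 * i + 1) = snd (?A (-1)) (2 * i + 1)" by simp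
  then show False by (simp add: persistence_cost_def)
qed

lemma generic_point_avoids:
  assumes "generic_point m n R x" "k < 2 * m + n" "r \<in> R"
  shows "x k \<noteq> r"
proof
  assume eq: "x k = r"
  let ?A = "\<lambda>s. coordinate_cost s k r"
  have "affine_eval (2 * m + n) (?A 1) x = affine_eval (2 * m + n) (?A (-1)) x"
    unfolding affine_eval_coordinate[OF assms(2)] using eq by simp
  then have "?A 1 = ?A (-1)"
    by (rule inj_onD[OF assms(1)[unfolded generic_point_def]])
      (rule coordinate_in_affine_costs, simp_all add: assms(2,3))+
  then have "snd (?A 1) k = snd (?A (-1)) k" by simp
  then show False by (simp add: coordinate_cost_def)
qed

text \<open>
  The possible values of the bottleneck distance to \<open>Q_map m n x\<close> that stay constant when the other
  barcode moves.
\<close>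

definition critical_values :: "nat \<Rightarrow> (nat \<Rightarrow> real) \<Rightarrow> real set" where
  "critical_values m x = insert 0 ((\<lambda>i. \<bar>x (2 * i + 1) - x (2 * i)\<bar> / 2) ` {..<m})"

lemma finite_critical_values: "finite (critical_values m x)"
  by (simp add: critical_values_def)

lemma half_persistence_bar_point:
  assumes "half_persistence (bar_point m x i) \<le> ereal c"
  shows "i < m" "half_persistence (bar_point m x i) = ereal (\<bar>x (2 * i + 1) - x (2 * i)\<bar> / 2)"
proof -
  show "i < m"
    using assms by (auto simp: bar_point_def half_persistence_def split: if_splits)
  then show "half_persistence (bar_point m x i) = ereal (\<bar>x (2 * i + 1) - x (2 * i)\<bar> / 2)"
    by (simp add: bar_point_def half_persistence_def)
qed

lemma dist_to_Q_map_cases: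
  assumes D0: "D0 = Q_map m0 n x0"
  shows "dist_to D0 (Q_map m n x) \<in> critical_values m0 x0 \<union>
    (\<lambda>A. affine_eval (2 * m + n) A x) ` affine_costs m n (x0 ` {..<2 * m0 + n})"
    (is "?f \<in> ?C \<union> ?A")
proof -
  have f: "bottleneck (Q_map m n x) D0 = ereal ?f"
    by (rule bottleneck_eq_dist_to(1)[where n = n]) (simp_all add: D0 Q_map_in_Bar_n)
  have "ereal ?f \<in> cost_values {..<m + n} (bar_point m x) {..<m0 + n} (bar_point m0 x0)"
    using f unfolding D0 Q_map_eq_barcode_on
    by (intro bottleneck_barcode_on_attained(1)) simp_all
  then consider "?f = 0"
    | i j where "i < m + n" "j < m0 + n" "point_dist (bar_point m x i) (bar_point m0 x0 j) = ereal ?f"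
    | i where "i < m + n" "half_persistence (bar_point m x i) = ereal ?f"
    | j where "j < m0 + n" "half_persistence (bar_point m0 x0 j) = ereal ?f"
    unfolding cost_values_def by (auto simp: zero_ereal_def)
  then show ?thesis
  proof cases
    case 1
    then show ?thesis by (simp add: critical_values_def)
  next
    case (2 i j)
    have "\<exists>k<2 * m + n. \<exists>l<2 * m0 + n. ?f = \<bar>x k - x0 l\<bar>"
    proof (cases "i < m")
      case True
      then have "j < m0" using 2(3) by (auto simp: bar_point_def point_dist_def split: if_splits)
      then have "?f = \<bar>x (2 * i) - x0 (2 * j)\<bar> \<or> ?f = \<bar>x (2 * i + 1) - x0 (2 * j + 1)\<bar>"
        using 2(3) True by (auto simp: bar_point_def point_dist_def max_def split: if_splits)
      moreover have "2 * i < 2 * m + n" "2 * i + 1 < 2 * m + n" "2 * j < 2 * m0 + n" "2 * j + 1 < 2 * m0 + n"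
        using True \<open>j < m0\<close> by simp_all
      ultimately show ?thesis by blast
    next
      case False
      then have "\<not> j < m0" using 2(3) by (auto simp: bar_point_def point_dist_def split: if_splits)
      then have "?f = \<bar>x (m + i) - x0 (m0 + j)\<bar>"
        using 2(3) False by (simp add: bar_point_def point_dist_def zero_ereal_def max_def split: if_splits)
      moreover have "m + i < 2 * m + n" "m0 + j < 2 * m0 + n" using 2(1,2) by simp_all
      ultimately show ?thesis by blast
    qed
    then obtain k l where "k < 2 * m + n" "l < 2 * m0 + n" "?f = \<bar>x k - x0 l\<bar>" by blast
    then show ?thesis
      using coordinate_cost_in_affine_costs[of k m n "x0 l" "x0 ` {..<2 * m0 + n}" x] by simp
  next
    case (3 i)
    then have i: "i < m" and f_eq: "?f = \<bar>x (2 * i + 1) - x (2 * i)\<bar> / 2"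
      using half_persistence_bar_point[of m x i ?f] by simp_all
    show ?thesis
      using persistence_cost_in_affine_costs[OF i, of x n "x0 ` {..<2 * m0 + n}"]
      unfolding f_eq[symmetric] by (rule UnI2)
  next
    case (4 j)
    then have "j < m0" "?f = \<bar>x0 (2 * j + 1) - x0 (2 * j)\<bar> / 2"
      using half_persistence_bar_point[of m0 x0 j ?f] by simp_all
    then show ?thesis by (auto simp: critical_values_def)
  qed
qed

text \<open>
  The distance and all the affine costs are 1-Lipschitz in the supremum norm. On a ball whose radius
  is a third of the gap between \<open>dist_to D0 (Q_map m n x)\<close> and all the other possible values, the
  distance can therefore only equal the cost that it equals at \<open>x\<close>.
\<close>

lemma dist_to_Q_map_locally_affine:
  assumes D0: "D0 = Q_map m0 n x0"
    and x: "generic_point m n (x0 ` {..<2 * m0 + n}) x"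
    and f: "dist_to D0 (Q_map m n x) \<notin> critical_values m0 x0"
  obtains A e where "A \<in> affine_costs m n (x0 ` {..<2 * m0 + n})" "0 < e"
    "\<And>z. (\<And>k. k < 2 * m + n \<Longrightarrow> \<bar>z k - x k\<bar> \<le> e) \<Longrightarrow>
       dist_to D0 (Q_map m n z) = affine_eval (2 * m + n) A z"
proof -
  let ?\<A> = "affine_costs m n (x0 ` {..<2 * m0 + n})"
  let ?ev = "affine_eval (2 * m + n)"
  let ?F = "\<lambda>z. dist_to D0 (Q_map m n z)"
  obtain A where A: "A \<in> ?\<A>" "?F x = ?ev A x"
    using dist_to_Q_map_cases[OF D0, of m x] f by blast
  define V where "V = critical_values m0 x0 \<union> (\<lambda>B. ?ev B x) ` (?\<A> - {A})"
  have "?F x \<notin> V"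
    using f A x unfolding V_def generic_point_def inj_on_def by auto
  moreover have "finite V"
    unfolding V_def by (intro finite_UnI finite_critical_values finite_imageI finite_Diff finite_affine_costs) simp
  ultimately obtain d where d: "0 < d" "\<And>v. v \<in> V \<Longrightarrow> d \<le> \<bar>?F x - v\<bar>"
    using finite_set_avoid[of V "?F x"] unfolding dist_real_def by metis
  show ?thesis
  proof (rule that[OF A(1)])
    show "0 < d / 3" using d(1) by simp
    fix z assume z: "\<And>k. k < 2 * m + n \<Longrightarrow> \<bar>z k - x k\<bar> \<le> d / 3"
    have close: "\<bar>?F z - ?F x\<bar> \<le> d / 3"
      by (rule dist_to_lipschitz[OF Q_map_in_Bar_n Q_map_in_Bar_n]) 
        (use z d(1) in \<open>auto simp: D0 Q_map_in_Bar_n intro: bottleneck_Q_map_le\<close>)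
    consider "?F z \<in> critical_values m0 x0" | B where "B \<in> ?\<A>" "?F z = ?ev B z"
      using dist_to_Q_map_cases[OF D0, of m z] by blast
    then show "?F z = ?ev A z"
    proof cases
      case 1
      then have "d \<le> \<bar>?F x - ?F z\<bar>" by (intro d(2)) (simp add: V_def)
      then show ?thesis using close d(1) by linarith
    next
      case (2 B)
      show ?thesis
      proof (cases "B = A")
        case False
        then have "d \<le> \<bar>?F x - ?ev B x\<bar>" using 2 by (intro d(2)) (simp add: V_def)
        moreover have "\<bar>?ev B z - ?ev B x\<bar> \<le> d / 3" by (rule affine_costs_lipschitz[OF 2(1) z])
        ultimately show ?thesis using close d(1) 2(2) by linarith
      qed (use 2 in simp)
    qed
  qed
qed

section \<open>Genericity\<close>

text \<open>
  The map on coordinates induced by a map \<open>\<sigma>\<close> on bars: births go to births, deaths to deaths and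
  infinite bars to infinite bars.
\<close>

definition reindex_coordinate :: "nat \<Rightarrow> nat \<Rightarrow> (nat \<Rightarrow> nat) \<Rightarrow> nat \<Rightarrow> nat" where
  "reindex_coordinate m m' \<sigma> k = (if k < 2 * m then 2 * \<sigma> (k div 2) + k mod 2 else m' + \<sigma> (k - m))"

lemma reindex_coordinate_simps:
  "i < m \<Longrightarrow> reindex_coordinate m m' \<sigma> (2 * i) = 2 * \<sigma> i"
  "i < m \<Longrightarrow> reindex_coordinate m m' \<sigma> (2 * i + 1) = 2 * \<sigma> i + 1"
  "m \<le> i \<Longrightarrow> reindex_coordinate m m' \<sigma> (m + i) = m' + \<sigma> i"
  by (simp_all add: reindex_coordinate_def)

lemma coordinate_cases:
  fixes k m n :: nat
  assumes "k < 2 * m + n"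
  obtains (birth) i where "i < m" "k = 2 * i" | (death) i where "i < m" "k = 2 * i + 1"
    | (infinite) i where "m \<le> i" "i < m + n" "k = m + i"
proof (cases "k < 2 * m")
  case True
  then have "k div 2 < m" by simp
  moreover have "k = 2 * (k div 2) \<or> k = 2 * (k div 2) + 1" by presburger
  ultimately show ?thesis using birth death by blast
next
  case False
  then show ?thesis using infinite[of "k - m"] assms by simp
qed

lemma reindex_coordinate_inj:
  assumes \<sigma>: "inj_on \<sigma> {..<m + n}" "\<sigma> ` {..<m + n} \<subseteq> {..<m' + n}"
    and type: "\<And>i. i < m + n \<Longrightarrow> \<sigma> i < m' \<longleftrightarrow> i < m"
  shows "inj_on (reindex_coordinate m m' \<sigma>) {..<2 * m + n}"
    and "reindex_coordinate m m' \<sigma> ` {..<2 * m + n} \<subseteq> {..<2 * m' + n}"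
proof -
  let ?\<tau> = "reindex_coordinate m m' \<sigma>"
  have finite_bar: "\<sigma> (k div 2) < m'" if "k < 2 * m" for k :: nat
  proof -
    have "k div 2 < m" using that by linarith
    then show ?thesis using type[of "k div 2"] by simp
  qed
  have infinite_bar: "\<not> \<sigma> (k - m) < m'" if "\<not> k < 2 * m" "k < 2 * m + n" for k
  proof -
    have "k - m < m + n" "\<not> k - m < m" using that by linarith+
    then show ?thesis using type[of "k - m"] by simp
  qed
  have no_clash: "2 * a + k mod 2 = m' + c \<Longrightarrow> a < m' \<Longrightarrow> \<not> c < m' \<Longrightarrow> False" for a c k
    using mod_less_divisor[of 2 k] by linarith
  show "inj_on ?\<tau> {..<2 * m + n}"
  proof (rule inj_onI)
    fix k l assume "k \<in> {..<2 * m + n}" "l \<in> {..<2 * m + n}" and eq: "?\<tau> k = ?\<tau> l"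
    then have kl: "k < 2 * m + n" "l < 2 * m + n" by simp_all
    have \<sigma>D: "i = j" if "i < m + n" "j < m + n" "\<sigma> i = \<sigma> j" for i j
      using inj_onD[OF \<sigma>(1), of i j] that by simp
    show "k = l"
    proof (cases "k < 2 * m"; cases "l < 2 * m")
      assume *: "k < 2 * m" "l < 2 * m"
      then have "2 * \<sigma> (k div 2) + k mod 2 = 2 * \<sigma> (l div 2) + l mod 2"
        using eq unfolding reindex_coordinate_def by (simp only: * if_True if_False)
      moreover have "a = c \<and> b = d" if "2 * a + b = 2 * c + d" "b < 2" "d < 2" for a b c d :: nat
        using that by presburger
      ultimately have "\<sigma> (k div 2) = \<sigma> (l div 2)" "k mod 2 = l mod 2"
        by (meson mod_less_divisor pos2)+
      moreover have "k div 2 < m + n" "l div 2 < m + n" using * by linarith+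
      then have "k div 2 = l div 2" by (rule \<sigma>D) fact
      ultimately show "k = l" by (metis div_mult_mod_eq)
    next
      assume *: "k < 2 * m" "\<not> l < 2 * m"
      then have "2 * \<sigma> (k div 2) + k mod 2 = m' + \<sigma> (l - m)"
        using eq unfolding reindex_coordinate_def by (simp only: * if_True if_False)
      from no_clash[OF this finite_bar[OF *(1)] infinite_bar[OF *(2) kl(2)]] show "k = l" ..
    next
      assume *: "\<not> k < 2 * m" "l < 2 * m"
      then have "2 * \<sigma> (l div 2) + l mod 2 = m' + \<sigma> (k - m)"
        using eq unfolding reindex_coordinate_def by (simp only: * if_True if_False)
      from no_clash[OF this finite_bar[OF *(2)] infinite_bar[OF *(1) kl(1)]] show "k = l" ..
    next
      assume *: "\<not> k < 2 * m" "\<not> l < 2 * m"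
      then have "\<sigma> (k - m) = \<sigma> (l - m)" using eq by (simp add: reindex_coordinate_def)
      moreover have "k - m < m + n" "l - m < m + n" using kl * by linarith+
      ultimately have "k - m = l - m" using \<sigma>D by blast
      then show "k = l" using * by linarith
    qed
  qed
  show "?\<tau> ` {..<2 * m + n} \<subseteq> {..<2 * m' + n}"
  proof (rule image_subsetI)
    fix k assume "k \<in> {..<2 * m + n}"
    then have k: "k < 2 * m + n" by simp
    show "?\<tau> k \<in> {..<2 * m' + n}"
    proof (cases "k < 2 * m")
      case True
      have "2 * \<sigma> (k div 2) + k mod 2 < 2 * m' + n" using finite_bar[OF True] by linarith
      then show ?thesis using True by (simp add: reindex_coordinate_def)
    next
      case False
      then have "k - m \<in> {..<m + n}" using k by simp
      then have "\<sigma> (k - m) < m' + n" using \<sigma>(2) by blast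
      then show ?thesis using False by (simp add: reindex_coordinate_def)
    qed
  qed
qed

lemma bar_point_reindex:
  assumes "i < m + n" "\<sigma> i < m' \<longleftrightarrow> i < m"
  shows "bar_point m (y \<circ> reindex_coordinate m m' \<sigma>) i = bar_point m' y (\<sigma> i)"
  using assms by (auto simp: bar_point_def reindex_coordinate_simps reindex_coordinate_simps(2)[simplified])

text \<open>
  When \<open>e\<close> is below half the persistence of every bar of \<open>Q_map m n x\<close>, a matching of cost \<open>e\<close>
  leaves none of them unmatched, so it is an injection \<open>\<sigma>\<close> into the bars of the nearby barcode. The
  bars outside its image are unmatched and hence short.
\<close>

lemma close_representations:
  assumes e: "\<And>i. i < m \<Longrightarrow> e < \<bar>x (2 * i + 1) - x (2 * i)\<bar> / 2"
    and close: "bottleneck (Q_map m n x) (Q_map m' n x') < ereal e"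
  obtains \<sigma> where "inj_on \<sigma> {..<m + n}" "\<sigma> ` {..<m + n} \<subseteq> {..<m' + n}"
    "\<And>i. i < m + n \<Longrightarrow> \<sigma> i < m' \<longleftrightarrow> i < m"
    "\<And>k. k < 2 * m + n \<Longrightarrow> \<bar>x' (reindex_coordinate m m' \<sigma> k) - x k\<bar> \<le> e"
    "\<And>j. j < m' + n \<Longrightarrow> j \<notin> \<sigma> ` {..<m + n} \<Longrightarrow>
       j < m' \<and> \<bar>x' (2 * j + 1) - x' (2 * j)\<bar> / 2 \<le> e"
proof -
  obtain M where "is_matching {..<m + n} (bar_point m x) {..<m' + n} (bar_point m' x') (ereal e) M"
    using matching_of_bottleneck_less[OF _ _ close[unfolded Q_map_eq_barcode_on]] by blast
  note matching = this and M = this[unfolded is_matching_def]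
  have "i \<in> fst ` M" if i: "i < m + n" for i
  proof (rule ccontr)
    assume "i \<notin> fst ` M"
    then have "half_persistence (bar_point m x i) \<le> ereal e" using M i by blast
    from half_persistence_bar_point[OF this] this e[of i] show False by simp
  qed
  then have "\<forall>i\<in>{..<m + n}. \<exists>j. (i, j) \<in> M" by force
  then obtain \<sigma> where \<sigma>: "\<And>i. i < m + n \<Longrightarrow> (i, \<sigma> i) \<in> M" by (metis lessThan_iff)
  have dist: "point_dist (bar_point m x i) (bar_point m' x' (\<sigma> i)) \<le> ereal e" if "i < m + n" for i
    using M \<sigma>[OF that] by blast
  have type: "\<sigma> i < m' \<longleftrightarrow> i < m" if "i < m + n" for i
    using dist[OF that] by (auto simp: bar_point_def point_dist_le_iff split: if_splits)
  show ?thesis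
  proof (rule that)
    show "inj_on \<sigma> {..<m + n}"
    proof (rule inj_onI)
      fix i j assume "i \<in> {..<m + n}" "j \<in> {..<m + n}" "\<sigma> i = \<sigma> j"
      then show "i = j"
        using \<sigma>[of i] \<sigma>[of j] is_matching_unique(2)[OF matching] by simp
    qed
    show "\<sigma> ` {..<m + n} \<subseteq> {..<m' + n}" using \<sigma> M by blast
    show "\<sigma> i < m' \<longleftrightarrow> i < m" if "i < m + n" for i by (rule type[OF that])
    show "\<bar>x' (reindex_coordinate m m' \<sigma> k) - x k\<bar> \<le> e" if "k < 2 * m + n" for k
      using that
    proof (cases k rule: coordinate_cases)
      case (birth i)
      then show ?thesis
        using dist[of i] type[of i]
        by (simp add: reindex_coordinate_simps bar_point_def point_dist_le_iff abs_minus_commute)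
    next
      case (death i)
      have "\<bar>x (2 * i) - x' (2 * \<sigma> i)\<bar> \<le> e"
        using dist[of i] type[of i] death(1) by (simp add: bar_point_def point_dist_le_iff)
      then have "0 \<le> e" by linarith
      moreover have "x (2 * i + 1) = x' (2 * \<sigma> i + 1) \<or> \<bar>x (2 * i + 1) - x' (2 * \<sigma> i + 1)\<bar> \<le> e"
        using dist[of i] type[of i] death by (auto simp: bar_point_def point_dist_le_iff)
      ultimately have "\<bar>x' (2 * \<sigma> i + 1) - x (2 * i + 1)\<bar> \<le> e" by (auto simp: abs_minus_commute)
      then show ?thesis unfolding death(2) reindex_coordinate_simps(2)[OF death(1)] .
    next
      case (infinite i)
      then show ?thesis
        using dist[of i] type[of i]
        by (simp add: reindex_coordinate_simps bar_point_def point_dist_le_iff abs_minus_commute)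
    qed
    fix j assume j: "j < m' + n" "j \<notin> \<sigma> ` {..<m + n}"
    have "j \<notin> snd ` M"
    proof
      assume "j \<in> snd ` M"
      then obtain i where i: "(i, j) \<in> M" by force
      then have "i < m + n" using M by blast
      then have "j = \<sigma> i" using is_matching_unique(1)[OF matching i \<sigma>] by simp
      then show False using j \<open>i < m + n\<close> by blast
    qed
    then have "half_persistence (bar_point m' x' j) \<le> ereal e" using M j by blast
    from half_persistence_bar_point[OF this] this
    show "j < m' \<and> \<bar>x' (2 * j + 1) - x' (2 * j)\<bar> / 2 \<le> e" by simp
  qed
qed

text \<open>
  Local affinity with the required gradients, in every parametrisation of \<open>D\<close>. Here \<open>x\<close> and \<open>y\<close>
  range over all functions, since \<open>Q_map m n\<close> only reads the first \<open>2 * m + n\<close> coordinates.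
\<close>

definition unit_or_half_gradient_at :: "barcode \<Rightarrow> nat \<Rightarrow> barcode \<Rightarrow> bool" where
  "unit_or_half_gradient_at D0 n D \<longleftrightarrow> (\<forall>m x. Q_map m n x = D \<longrightarrow>
     (\<exists>\<delta>>0. \<exists>A. (one_unit_component (2 * m + n) (snd A) \<or> two_half_components (2 * m + n) (snd A)) \<and>
        (\<forall>y. (\<forall>k<2 * m + n. \<bar>y k - x k\<bar> < \<delta>) \<longrightarrow>
           dist_to D0 (Q_map m n y) = affine_eval (2 * m + n) A y)))"

text \<open>
  Let \<open>x'\<close> parametrise a barcode close to \<open>Q_map m n x\<close>, and let \<open>\<sigma>\<close> embed the bars of \<open>x\<close> into
  those of \<open>x'\<close>. For all \<open>y\<close> near \<open>x'\<close>, the bars of \<open>y\<close> outside the image of \<open>\<sigma>\<close> are short and can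
  be discarded, and what remains is \<open>Q_map m n (y \<circ> \<tau>)\<close> with \<open>y \<circ> \<tau>\<close> near \<open>x\<close>, where the distance is
  known to be affine. The same \<open>\<sigma>\<close> serves for all \<open>y\<close>.
\<close>

lemma unit_or_half_gradient_near_generic:
  assumes D0: "D0 = Q_map m0 n x0"
    and x: "generic_point m n (x0 ` {..<2 * m0 + n}) x"
    and f: "dist_to D0 (Q_map m n x) \<notin> critical_values m0 x0"
  shows "\<exists>e>0. \<forall>D' \<in> Bar_n n. bottleneck (Q_map m n x) D' < ereal e \<longrightarrow>
    unit_or_half_gradient_at D0 n D'"
proof -
  define f where "f = dist_to D0 (Q_map m n x)"
  obtain A \<eta> where A: "A \<in> affine_costs m n (x0 ` {..<2 * m0 + n})" and "0 < \<eta>"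
    and local: "\<And>z. (\<And>k. k < 2 * m + n \<Longrightarrow> \<bar>z k - x k\<bar> \<le> \<eta>) \<Longrightarrow>
       dist_to D0 (Q_map m n z) = affine_eval (2 * m + n) A z"
    using dist_to_Q_map_locally_affine[OF assms] by blast
  have D0_Bar: "D0 \<in> Bar_n n" by (simp add: D0 Q_map_in_Bar_n)
  obtain d where d: "0 < d" "\<And>c. c \<in> critical_values m0 x0 \<Longrightarrow> d \<le> \<bar>f - c\<bar>"
    using finite_set_avoid[OF finite_critical_values[of m0 x0], of f] assms(3)
    unfolding dist_real_def f_def by metis
  have "0 \<le> f" unfolding f_def using bottleneck_eq_dist_to(2)[OF Q_map_in_Bar_n D0_Bar] .
  then have "d \<le> f" using d(2)[of 0] by (simp add: critical_values_def)
  define h where "h = Min (insert 1 ((\<lambda>i. \<bar>x (2 * i + 1) - x (2 * i)\<bar> / 2) ` {..<m}))"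
  have "0 < h"
  proof -
    have "x (2 * i + 1) \<noteq> x (2 * i)" if "i < m" for i
      using generic_point_off_diagonal[OF x that] by simp
    then show ?thesis unfolding h_def by simp
  qed
  have h: "h \<le> \<bar>x (2 * i + 1) - x (2 * i)\<bar> / 2" if "i < m" for i
    unfolding h_def using that by (intro Min_le) auto
  \<comment> \<open>points \<open>y\<close> within \<open>e\<close> of \<open>x'\<close> have short bars of half persistence at most \<open>2 * e\<close> and distance
    within \<open>2 * e\<close> of \<open>f\<close>, so a gap of \<open>8 * e\<close> around \<open>f\<close> suffices for discarding those bars\<close>
  define e where "e = min (h / 2) (min (\<eta> / 2) (d / 8))"
  have e: "0 < e" "e < h" "2 * e \<le> \<eta>" "8 * e \<le> d"
    using \<open>0 < h\<close> \<open>0 < \<eta>\<close> \<open>0 < d\<close> by (auto simp: e_def)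
  show ?thesis
  proof (intro exI[of _ e] conjI e(1) ballI impI)
    fix D' assume D': "D' \<in> Bar_n n" and close: "bottleneck (Q_map m n x) D' < ereal e"
    show "unit_or_half_gradient_at D0 n D'"
      unfolding unit_or_half_gradient_at_def
    proof (intro allI impI)
      fix m' x' assume Q': "Q_map m' n x' = D'"
      have e_less: "e < \<bar>x (2 * i + 1) - x (2 * i)\<bar> / 2" if "i < m" for i
        using h[OF that] e(2) by linarith
      obtain \<sigma> where \<sigma>: "inj_on \<sigma> {..<m + n}" "\<sigma> ` {..<m + n} \<subseteq> {..<m' + n}"
        and type: "\<And>i. i < m + n \<Longrightarrow> \<sigma> i < m' \<longleftrightarrow> i < m"
        and near: "\<And>k. k < 2 * m + n \<Longrightarrow> \<bar>x' (reindex_coordinate m m' \<sigma> k) - x k\<bar> \<le> e"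
        and small: "\<And>j. j < m' + n \<Longrightarrow> j \<notin> \<sigma> ` {..<m + n} \<Longrightarrow>
           j < m' \<and> \<bar>x' (2 * j + 1) - x' (2 * j)\<bar> / 2 \<le> e"
        using close_representations[OF e_less close[folded Q']] by blast
      define \<tau> where "\<tau> = reindex_coordinate m m' \<sigma>"
      note \<tau> = reindex_coordinate_inj[OF \<sigma> type, folded \<tau>_def]
      define A' where "A' = pullback_affine (2 * m + n) \<tau> A"
      have comp: "one_unit_component (2 * m' + n) (snd A') \<or> two_half_components (2 * m' + n) (snd A')"
        using affine_costs_component[OF A] one_unit_component_pullback[OF \<tau>]
          two_half_components_pullback[OF \<tau>] unfolding A'_def by blast
      have "dist_to D0 (Q_map m' n y) = affine_eval (2 * m' + n) A' y"
        if y: "\<And>k. k < 2 * m' + n \<Longrightarrow> \<bar>y k - x' k\<bar> < e" for y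
      proof -
        have z: "\<bar>(y \<circ> \<tau>) k - x k\<bar> \<le> 2 * e" if k: "k < 2 * m + n" for k
        proof -
          have "\<tau> k < 2 * m' + n" using \<tau>(2) k by blast
          then show ?thesis using y[of "\<tau> k"] near[OF k] by (simp add: \<tau>_def)
        qed
        define g where "g = dist_to D0 (Q_map m n (y \<circ> \<tau>))"
        define f' where "f' = dist_to D0 (Q_map m' n y)"
        have g: "bottleneck (Q_map m n (y \<circ> \<tau>)) D0 = ereal g" "0 \<le> g"
          unfolding g_def by (rule bottleneck_eq_dist_to[OF Q_map_in_Bar_n D0_Bar])+
        have f': "bottleneck (Q_map m' n y) D0 = ereal f'" "0 \<le> f'"
          unfolding f'_def by (rule bottleneck_eq_dist_to[OF Q_map_in_Bar_n D0_Bar])+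
        have "\<bar>g - f\<bar> \<le> 2 * e"
          unfolding g_def f_def
          by (rule dist_to_lipschitz[OF Q_map_in_Bar_n Q_map_in_Bar_n D0_Bar bottleneck_Q_map_le])
            (use z e(1) in auto)
        have "\<bar>f' - f\<bar> \<le> e + e"
        proof -
          have "bottleneck (Q_map m' n y) D' \<le> ereal e"
            unfolding Q'[symmetric] using y e(1) by (intro bottleneck_Q_map_le) (auto intro: less_imp_le)
          moreover have "bottleneck D' (Q_map m n x) \<le> ereal e"
            using close by (simp add: bottleneck_commute)
          ultimately show ?thesis
            unfolding f'_def f_def
            by (intro dist_to_lipschitz[OF Q_map_in_Bar_n Q_map_in_Bar_n D0_Bar] bottleneck_triangle)
        qed
        have "f' = g"
        proof (rule bottleneck_remove_small_points)
          show "finite {..<m' + n}" "finite {..<m0 + n}" by simp_all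
          show "\<sigma> ` {..<m + n} \<subseteq> {..<m' + n}" by (rule \<sigma>(2))
          show "bottleneck (barcode_on {..<m' + n} (bar_point m' y))
              (barcode_on {..<m0 + n} (bar_point m0 x0)) = ereal f'"
            using f'(1) unfolding D0 Q_map_eq_barcode_on .
          have "barcode_on (\<sigma> ` {..<m + n}) (bar_point m' y) =
              barcode_on {..<m + n} (bar_point m' y \<circ> \<sigma>)"
            by (rule barcode_on_reindex[OF \<sigma>(1)])
          also have "\<dots> = barcode_on {..<m + n} (bar_point m (y \<circ> \<tau>))"
            unfolding barcode_on_def
            by (intro arg_cong[of _ _ barcode_of] image_mset_cong)
              (simp add: \<tau>_def bar_point_reindex type)
          finally show "bottleneck (barcode_on (\<sigma> ` {..<m + n}) (bar_point m' y))
              (barcode_on {..<m0 + n} (bar_point m0 x0)) = ereal g"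
            using g(1) unfolding D0 Q_map_eq_barcode_on by simp
          show "0 \<le> f'" "0 \<le> g" by (fact f' g)+
          show "2 * e \<le> g" using \<open>\<bar>g - f\<bar> \<le> 2 * e\<close> \<open>d \<le> f\<close> e by linarith
          fix j
          {
            assume "j \<in> {..<m' + n} - \<sigma> ` {..<m + n}"
            then have j: "j < m'" "\<bar>x' (2 * j + 1) - x' (2 * j)\<bar> / 2 \<le> e" using small[of j] by auto
            have "\<bar>y (2 * j + 1) - x' (2 * j + 1)\<bar> < e" "\<bar>y (2 * j) - x' (2 * j)\<bar> < e"
              using j(1) by (auto intro!: y)
            then have "\<bar>y (2 * j + 1) - y (2 * j)\<bar> \<le> 2 * (2 * e)" using j(2) by argo
            then show "half_persistence (bar_point m' y j) \<le> ereal (2 * e)"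
              using j(1) by (simp add: bar_point_def half_persistence_le_iff)
          next
            assume *: "half_persistence (bar_point m0 x0 j) \<le> ereal (2 * e + f')"
            define c where "c = \<bar>x0 (2 * j + 1) - x0 (2 * j)\<bar> / 2"
            have c: "j < m0" "half_persistence (bar_point m0 x0 j) = ereal c"
              unfolding c_def by (rule half_persistence_bar_point[OF *])+
            then have "d \<le> \<bar>f - c\<bar>" by (intro d(2)) (simp add: critical_values_def c_def)
            moreover have "c \<le> 2 * e + f'" using * c(2) by simp
            ultimately have "c \<le> f'" using \<open>\<bar>f' - f\<bar> \<le> e + e\<close> e(1,4) by argo
            then show "half_persistence (bar_point m0 x0 j) \<le> ereal f'" by (simp add: c(2))
          }
        qed
        also have "g = affine_eval (2 * m + n) A (y \<circ> \<tau>)"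
          unfolding g_def by (rule local) (use z e(3) in \<open>force intro: order_trans\<close>)
        also have "\<dots> = affine_eval (2 * m' + n) A' y"
          unfolding A'_def by (rule affine_eval_pullback[OF \<tau>, symmetric])
        finally show ?thesis by (simp add: f'_def)
      qed
      with comp e(1) show "\<exists>\<delta>>0. \<exists>A. (one_unit_component (2 * m' + n) (snd A) \<or>
            two_half_components (2 * m' + n) (snd A)) \<and>
          (\<forall>y. (\<forall>k<2 * m' + n. \<bar>y k - x' k\<bar> < \<delta>) \<longrightarrow>
            dist_to D0 (Q_map m' n y) = affine_eval (2 * m' + n) A y)"
        by blast
    qed
  qed
qed

lemma unit_or_half_gradient_at_imp:
  assumes D: "unit_or_half_gradient_at D0 n D" and x: "x \<in> topspace (Euclidean_space (2 * m + n))"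
    and Q: "Q_map m n x = D"
  shows "\<exists>U. openin (Euclidean_space (2 * m + n)) U \<and> x \<in> U \<and>
      Cinf_on (2 * m + n) (dist_to D0 \<circ> Q_map m n) U"
    and "one_unit_component (2 * m + n) (gradient (2 * m + n) (dist_to D0 \<circ> Q_map m n) x) \<or>
      two_half_components (2 * m + n) (gradient (2 * m + n) (dist_to D0 \<circ> Q_map m n) x)"
proof -
  let ?N = "2 * m + n" and ?f = "dist_to D0 \<circ> Q_map m n"
  obtain \<delta> A where "0 < \<delta>"
    and A: "one_unit_component ?N (snd A) \<or> two_half_components ?N (snd A)"
    and f: "\<And>y. (\<forall>k<?N. \<bar>y k - x k\<bar> < \<delta>) \<Longrightarrow> dist_to D0 (Q_map m n y) = affine_eval ?N A y"
    using D Q unfolding unit_or_half_gradient_at_def by blast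
  define U where "U = {y \<in> topspace (Euclidean_space ?N). \<forall>k<?N. \<bar>y k - x k\<bar> < \<delta>}"
  have U: "openin (Euclidean_space ?N) U" unfolding U_def by (rule openin_sup_ball)
  have "x \<in> U" using x \<open>0 < \<delta>\<close> by (simp add: U_def)
  have fU: "?f y = affine_eval ?N A y" if "y \<in> U" for y
    using f that by (simp add: U_def)
  show "\<exists>U. openin (Euclidean_space ?N) U \<and> x \<in> U \<and> Cinf_on ?N ?f U"
    using U \<open>x \<in> U\<close> Cinf_on_locally_affine[OF U fU] by blast
  have grad: "gradient ?N ?f x k = snd A k" if "k < ?N" for k
  proof -
    have "partial_deriv k ?f x = snd A k"
      by (rule partial_deriv_locally_affine[OF U \<open>x \<in> U\<close> that]) (rule fU)
    with that show ?thesis by (simp add: gradient_def)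
  qed
  have supp: "{k. k < ?N \<and> gradient ?N ?f x k \<noteq> 0} = {k. k < ?N \<and> snd A k \<noteq> 0}"
    using grad by auto
  show "one_unit_component ?N (gradient ?N ?f x) \<or> two_half_components ?N (gradient ?N ?f x)"
    using A
  proof
    assume "one_unit_component ?N (snd A)"
    then obtain i where i: "{k. k < ?N \<and> snd A k \<noteq> 0} = {i}" "snd A i = 1 \<or> snd A i = - 1"
      unfolding one_unit_component_def by blast
    then have "i < ?N" by blast
    then have "one_unit_component ?N (gradient ?N ?f x)"
      unfolding one_unit_component_def supp using i grad by auto
    then show ?thesis ..
  next
    assume "two_half_components ?N (snd A)"
    then obtain i j where ij: "i \<noteq> j" "{k. k < ?N \<and> snd A k \<noteq> 0} = {i, j}"
      "snd A i = 1 / 2" "snd A j = - 1 / 2"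
      unfolding two_half_components_def by blast
    then have "i < ?N" "j < ?N" by blast+
    then have "two_half_components ?N (gradient ?N ?f x)"
      unfolding two_half_components_def supp using ij grad by (intro exI[of _ i] exI[of _ j]) simp
    then show ?thesis ..
  qed
qed

text \<open>
  A bar on the diagonal is appended before moving to a generic point, so that there is at least one
  finite bar. This excludes barcodes without any coordinate to differentiate in, and gives
  positive distance to \<open>D0\<close> below.
\<close>

lemma exists_generic_near:
  assumes D0: "D0 = Q_map m0 n x0" and D: "D \<in> Bar_n n" and "0 < e"
  obtains m x where "0 < m" "bottleneck D (Q_map m n x) \<le> ereal e"
    "generic_point m n (x0 ` {..<2 * m0 + n}) x"
proof -
  obtain m' x' where D': "D = Q_map m' n x'" using Bar_n_imp_Q_map[OF D] by blast
  \<comment> \<open>the new diagonal bar has index \<open>m'\<close>; the infinite bars are shifted past it\<close>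
  define \<sigma> where "\<sigma> i = (if i < m' then i else Suc i)" for i
  define y where "y k = (if k < 2 * m' then x' k else if k < 2 * m' + 2 then 0 else x' (k - 2))" for k
  have "D = Q_map (Suc m') n y"
  proof (rule ext)
    fix p
    show "D p = Q_map (Suc m') n y p"
    proof (cases "p \<in> range diag")
      case True
      then show ?thesis by (simp add: D' Q_map_eq_barcode_on barcode_on_apply)
    next
      case False
      have "bar_point (Suc m') y m' = diag 0" by (simp add: bar_point_def y_def)
      then have ne: "bar_point (Suc m') y m' \<noteq> p" using False by auto
      have eq: "bar_point (Suc m') y (\<sigma> i) = bar_point m' x' i" for i
        by (auto simp: bar_point_def \<sigma>_def y_def)
      have "{i \<in> {..<Suc m' + n}. bar_point (Suc m') y i = p} =
          \<sigma> ` {i \<in> {..<m' + n}. bar_point m' x' i = p}"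
      proof (intro set_eqI iffI)
        fix i assume i: "i \<in> {i \<in> {..<Suc m' + n}. bar_point (Suc m') y i = p}"
        then have "i \<noteq> m'" using ne by auto
        define j where "j = (if i < m' then i else i - 1)"
        have j: "i = \<sigma> j" "j < m' + n"
          using i \<open>i \<noteq> m'\<close> by (auto simp: \<sigma>_def j_def)
        then have "bar_point m' x' j = p" using i eq[of j] by simp
        with j show "i \<in> \<sigma> ` {i \<in> {..<m' + n}. bar_point m' x' i = p}" by blast
      next
        fix i assume "i \<in> \<sigma> ` {i \<in> {..<m' + n}. bar_point m' x' i = p}"
        then obtain j where "i = \<sigma> j" "j < m' + n" "bar_point m' x' j = p" by blast
        moreover from this have "\<sigma> j < Suc m' + n" by (simp add: \<sigma>_def)
        ultimately show "i \<in> {i \<in> {..<Suc m' + n}. bar_point (Suc m') y i = p}" by (simp add: eq)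
      qed
      moreover have "inj \<sigma>" by (auto simp: inj_def \<sigma>_def split: if_splits)
      ultimately show ?thesis
        using False by (simp add: D' Q_map_eq_barcode_on barcode_on_apply card_image inj_on_subset)
    qed
  qed
  moreover obtain z where "\<And>k. \<bar>z k - y k\<bar> < e" "generic_point (Suc m') n (x0 ` {..<2 * m0 + n}) z"
    using generic_point_exists[of "x0 ` {..<2 * m0 + n}" e y "Suc m'" n] \<open>0 < e\<close> by blast
  moreover from this have "bottleneck (Q_map (Suc m') n y) (Q_map (Suc m') n z) \<le> ereal e"
    using \<open>0 < e\<close> by (intro bottleneck_Q_map_le) (auto simp: abs_minus_commute less_imp_le)
  ultimately show ?thesis using that[of "Suc m'" z] by simp
qed

text \<open>
  At distance zero the first bar would have to lie on the diagonal or coincide with a bar of \<open>D0\<close>.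
\<close>

lemma dist_to_pos_of_generic:
  assumes D0: "D0 = Q_map m0 n x0" and "0 < m"
    and x: "generic_point m n (x0 ` {..<2 * m0 + n}) x"
  shows "0 < dist_to D0 (Q_map m n x)"
proof -
  have D0_Bar: "D0 \<in> Bar_n n" by (simp add: D0 Q_map_in_Bar_n)
  have "dist_to D0 (Q_map m n x) \<noteq> 0"
  proof
    assume "dist_to D0 (Q_map m n x) = 0"
    then have "bottleneck (Q_map m n x) D0 = ereal 0"
      using bottleneck_eq_dist_to(1)[OF Q_map_in_Bar_n D0_Bar, of m x] by simp
    then obtain M where "is_matching {..<m + n} (bar_point m x) {..<m0 + n} (bar_point m0 x0) (ereal 0) M"
      using bottleneck_barcode_on_attained(2)[of "{..<m + n}" "{..<m0 + n}"]
      unfolding D0 Q_map_eq_barcode_on by blast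
    note M = this[unfolded is_matching_def]
    show False
    proof (cases "0 \<in> fst ` M")
      case True
      then obtain j where "(0, j) \<in> M" by force
      then have j: "j < m0 + n" "point_dist (bar_point m x 0) (bar_point m0 x0 j) \<le> ereal 0"
        using M by blast+
      then have "j < m0" "x 0 = x0 (2 * j)"
        using \<open>0 < m\<close> by (auto simp: bar_point_def point_dist_le_iff split: if_splits)
      then show False
        using generic_point_avoids[OF x, of 0 "x0 (2 * j)"] \<open>0 < m\<close> by simp
    next
      case False
      then have "half_persistence (bar_point m x 0) \<le> ereal 0" using M \<open>0 < m\<close> by simp
      then have "x 1 = x 0" using \<open>0 < m\<close> by (simp add: bar_point_def half_persistence_le_iff)
      then show False using generic_point_off_diagonal[OF x \<open>0 < m\<close>] by simp
    qed
  qed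
  then show ?thesis using bottleneck_eq_dist_to(2)[OF Q_map_in_Bar_n D0_Bar, of m x] by simp
qed

text \<open>
  Three small moves: to a generic point, so that the distance to \<open>D0\<close> is positive; along a geodesic
  towards \<open>D0\<close>, so that the distance leaves the finite set of critical values; and again to a
  generic point, so close that the distance stays noncritical.
\<close>

lemma exists_noncritical_generic_near:
  assumes D0: "D0 = Q_map m0 n x0" and D: "D \<in> Bar_n n" and "0 < e"
  obtains m x where "bottleneck D (Q_map m n x) < ereal e"
    "generic_point m n (x0 ` {..<2 * m0 + n}) x" "dist_to D0 (Q_map m n x) \<notin> critical_values m0 x0"
proof -
  have D0_Bar: "D0 \<in> Bar_n n" by (simp add: D0 Q_map_in_Bar_n)
  obtain m1 x1 where x1: "0 < m1" "bottleneck D (Q_map m1 n x1) \<le> ereal (e / 4)"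
    "generic_point m1 n (x0 ` {..<2 * m0 + n}) x1"
    using exists_generic_near[OF D0 D, of "e / 4"] \<open>0 < e\<close> by auto
  define f where "f = dist_to D0 (Q_map m1 n x1)"
  have "0 < f" unfolding f_def by (rule dist_to_pos_of_generic[OF D0 x1(1,3)])
  define s where "s = min 1 (e / (4 * f))"
  have "0 < s" using \<open>0 < f\<close> \<open>0 < e\<close> by (simp add: s_def)
  then have "infinite {0<..<s}" by simp
  moreover have "finite {t. (1 - t) * f \<in> critical_values m0 x0}"
  proof (rule finite_subset)
    show "{t. (1 - t) * f \<in> critical_values m0 x0} \<subseteq> (\<lambda>c. 1 - c / f) ` critical_values m0 x0"
      using \<open>0 < f\<close> by (auto simp: image_iff intro!: bexI[rotated])
  qed (simp add: finite_critical_values)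
  ultimately obtain t where t: "t \<in> {0<..<s}" "(1 - t) * f \<notin> critical_values m0 x0"
    by (metis (mono_tags, lifting) finite_subset mem_Collect_eq subsetI)
  have t': "0 \<le> t" "t \<le> 1" using t(1) by (auto simp: s_def)
  have "t * f \<le> e / 4" using t(1) \<open>0 < f\<close> by (auto simp: s_def field_simps)
  obtain D2 where D2: "D2 \<in> Bar_n n" "bottleneck (Q_map m1 n x1) D2 \<le> ereal (t * f)"
    "dist_to D0 D2 = (1 - t) * f"
    using bottleneck_geodesic[OF Q_map_in_Bar_n D0_Bar t', of m1 x1] unfolding f_def by blast
  obtain d where d: "0 < d" "\<And>c. c \<in> critical_values m0 x0 \<Longrightarrow> d \<le> \<bar>dist_to D0 D2 - c\<bar>"
    using finite_set_avoid[OF finite_critical_values[of m0 x0], of "dist_to D0 D2"] t(2) D2(3)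
    unfolding dist_real_def by metis
  define e' where "e' = min (e / 4) (d / 2)"
  have e': "0 < e'" "e' \<le> e / 4" "e' < d" using \<open>0 < e\<close> d(1) by (auto simp: e'_def)
  obtain m3 x3 where x3: "bottleneck D2 (Q_map m3 n x3) \<le> ereal e'"
    "generic_point m3 n (x0 ` {..<2 * m0 + n}) x3"
    using exists_generic_near[OF D0 D2(1) e'(1)] by blast
  have "\<bar>dist_to D0 D2 - dist_to D0 (Q_map m3 n x3)\<bar> \<le> e'"
    by (rule dist_to_lipschitz[OF D2(1) Q_map_in_Bar_n D0_Bar x3(1)])
  then have "dist_to D0 (Q_map m3 n x3) \<notin> critical_values m0 x0" using d(2) e'(3) by force
  moreover have "bottleneck D (Q_map m3 n x3) \<le> ereal (e / 4 + (t * f + e'))"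
    by (rule bottleneck_triangle[OF x1(2) bottleneck_triangle[OF D2(2) x3(1)]])
  then have "bottleneck D (Q_map m3 n x3) < ereal e"
    by (rule order_le_less_trans) (use \<open>t * f \<le> e / 4\<close> e'(2) \<open>0 < e\<close> in simp)
  ultimately show ?thesis using that x3(2) by blast
qed

theorem propositionB1:
  fixes D0 :: barcode and n :: nat
  assumes "D0 \<in> Bar" and "n = num_infinite_bars D0"
  shows "\<exists>U. openin (Bar_topology n) U \<and>
           Bar_topology n closure_of U = topspace (Bar_topology n) \<and>
           (\<forall>D \<in> U. inf_differentiable_at n (dist_to D0) D \<and>
              (\<forall>m. \<forall>x \<in> topspace (Euclidean_space (2 * m + n)). Q_map m n x = D \<longrightarrow>
                 (let N = 2 * m + n; g = gradient N (dist_to D0 \<circ> Q_map m n) x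
                  in (two_half_components N g \<and> \<not> one_unit_component N g) \<or>
                     (one_unit_component N g \<and> \<not> two_half_components N g))))"
proof -
  have D0_Bar: "D0 \<in> Bar_n n" using assms by (simp add: Bar_n_def)
  then obtain m0 x0 where D0: "D0 = Q_map m0 n x0" by (rule Bar_n_imp_Q_map)
  define U where "U = {D \<in> Bar_n n. \<exists>e>0. \<forall>D' \<in> Bar_n n. bottleneck D D' < ereal e \<longrightarrow>
    unit_or_half_gradient_at D0 n D'}"
  have self: "bottleneck D D \<le> ereal 0" if "D \<in> Bar_n n" for D
  proof -
    obtain m x where "D = Q_map m n x" using Bar_n_imp_Q_map[OF \<open>D \<in> Bar_n n\<close>] by blast
    then show ?thesis using bottleneck_Q_map_le[of 0 m n x x] by simp
  qed
  have "openin (Bar_topology n) U"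
    unfolding openin_Bar_topology
  proof (intro conjI ballI)
    show "U \<subseteq> Bar_n n" by (auto simp: U_def)
    fix D assume "D \<in> U"
    then obtain e where e: "0 < e" "D \<in> Bar_n n"
      "\<And>D'. D' \<in> Bar_n n \<Longrightarrow> bottleneck D D' < ereal e \<Longrightarrow> unit_or_half_gradient_at D0 n D'"
      unfolding U_def by blast
    have "D' \<in> U" if D': "D' \<in> Bar_n n" "bottleneck D D' < ereal (e / 2)" for D'
      unfolding U_def
    proof (intro CollectI conjI exI[of _ "e / 2"] ballI impI)
      fix D'' assume D'': "D'' \<in> Bar_n n" "bottleneck D' D'' < ereal (e / 2)"
      obtain c where c: "bottleneck D D' = ereal c" using bottleneck_Bar_n_finite[OF e(2) D'(1)] by blast
      obtain c' where c': "bottleneck D' D'' = ereal c'" using bottleneck_Bar_n_finite[OF D'(1) D''(1)] by blast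
      have "bottleneck D D'' \<le> ereal (c + c')" by (rule bottleneck_triangle[of D D']) (simp_all add: c c')
      moreover have "c + c' < e" using D'(2) D''(2) c c' by simp
      ultimately have "bottleneck D D'' < ereal e" by (simp add: order_le_less_trans)
      then show "unit_or_half_gradient_at D0 n D''" by (rule e(3)[OF D''(1)])
    qed (use e(1) D' in auto)
    then show "\<exists>e>0. \<forall>D'\<in>Bar_n n. bottleneck D D' < ereal e \<longrightarrow> D' \<in> U"
      using e(1) by (intro exI[of _ "e / 2"]) auto
  qed
  moreover have "Bar_topology n closure_of U = topspace (Bar_topology n)"
    unfolding dense_intersects_open
  proof (intro allI impI)
    fix V assume V: "openin (Bar_topology n) V \<and> V \<noteq> {}"
    then obtain D where "D \<in> V" by blast
    with V obtain e where e: "0 < e" "\<And>D'. D' \<in> Bar_n n \<Longrightarrow> bottleneck D D' < ereal e \<Longrightarrow> D' \<in> V"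
      and D: "D \<in> Bar_n n"
      unfolding openin_Bar_topology by blast
    obtain m x where x: "bottleneck D (Q_map m n x) < ereal e"
      "generic_point m n (x0 ` {..<2 * m0 + n}) x" "dist_to D0 (Q_map m n x) \<notin> critical_values m0 x0"
      using exists_noncritical_generic_near[OF D0 D e(1)] by blast
    have "Q_map m n x \<in> U"
      unfolding U_def
      by (intro CollectI conjI Q_map_in_Bar_n unit_or_half_gradient_near_generic[OF D0 x(2,3)])
    moreover have "Q_map m n x \<in> V" by (rule e(2)[OF Q_map_in_Bar_n x(1)])
    ultimately show "U \<inter> V \<noteq> {}" by blast
  qed
  moreover have "unit_or_half_gradient_at D0 n D" if "D \<in> U" for D
  proof -
    obtain e where "0 < e" "D \<in> Bar_n n"
      "\<And>D'. D' \<in> Bar_n n \<Longrightarrow> bottleneck D D' < ereal e \<Longrightarrow> unit_or_half_gradient_at D0 n D'"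
      using \<open>D \<in> U\<close> unfolding U_def by blast
    moreover from this have "bottleneck D D < ereal e"
      using order_le_less_trans[OF self[of D], of "ereal e"] by simp
    ultimately show ?thesis by blast
  qed
  ultimately show ?thesis
  proof (intro exI[of _ U] conjI ballI allI impI)
    fix D assume "D \<in> U" and good: "\<And>D. D \<in> U \<Longrightarrow> unit_or_half_gradient_at D0 n D"
    note imp = unit_or_half_gradient_at_imp[OF good[OF \<open>D \<in> U\<close>]]
    show "inf_differentiable_at n (dist_to D0) D"
      unfolding inf_differentiable_at_def by (intro allI ballI impI imp(1))
    fix m x assume "x \<in> topspace (Euclidean_space (2 * m + n))" "Q_map m n x = D"
    from imp(2)[OF this]
    show "let N = 2 * m + n; g = gradient N (dist_to D0 \<circ> Q_map m n) x
        in (two_half_components N g \<and> \<not> one_unit_component N g) \<or>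
           (one_unit_component N g \<and> \<not> two_half_components N g)"
      unfolding Let_def using not_one_unit_and_two_half by blast
  qed
qed

end
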